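(* Fix $d\ge1$. For all partitions $\mu\subseteq\lambda$ with $\ell(\lambda)\le d$ (set $\lambda_i=0$ for $i>\ell(\lambda)$), as rational functions in $\beta,q$, $$\sum_{T\in\operatorname{SIT}(\lambda/\mu)}\prod_{k=1}^{m(T)}\left(\left[\prod_{i=1}^d\frac{1+\beta q^{\nu_i(T_{<k})+d-i+1}}{1+\beta q^{\lambda_i+d-i+1}}\right]-1\right)^{-1}=\sum_{D\in\mathcal D(\lambda/\mu)}\beta^{|D|-|\lambda|}\prod_{(i,j)\in\lambda\setminus D}\frac{\beta q^{\lambda_i+d-i+1}+1}{q^{d+j-\lambda'_j}\big(1-q^{h(i,j)}\big)}.$$
   Context: Partitions are identified with Young diagrams $\{(i,j):1\le j\le\lambda_i\}$ (English convention); $\lambda'$ is the conjugate, $h(i,j)=\lambda_i-j+\lambda'_j-i+1$ the hook length in $\lambda$, $|\cdot|$ counts cells. A standard increasing tableau of shape $\lambda/\mu$ is a filling $T$ of the cells of $\lambda/\mu$ by positive integers, strictly increasing along rows and down columns, with set of entries $\{1,\dots,m\}$ for some $m=m(T)$; $\operatorname{SIT}(\lambda/\mu)$ is their set. $\nu(T_{<k})$ is the partition whose diagram is $\mu$ together with the cells of $\lambda/\mu$ with entry $<k$, with parts $\nu_i(T_{<k})$. Generalized excited diagrams: for $S\subseteq\lambda$, a cell $(i,j)\in S$ is active if $(i+1,j),(i,j+1),(i+1,j+1)\in\lambda\setminus S$; for active $(i,j)$ the type I move replaces $(i,j)$ by $(i+1,j+1)$ and the type II move adds $(i+1,j+1)$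 to $S$. $\mathcal D(\lambda/\mu)$ is the set of subsets of $\lambda$ obtainable from the diagram of $\mu$ by sequences of type I and II moves. *)

theory Defs
  imports "HOL-Computational_Algebra.Polynomial" "HOL-Computational_Algebra.Fraction_Field"
begin

definition is_partition :: "nat list \<Rightarrow> bool" where
  "is_partition l \<longleftrightarrow> sorted_wrt (\<ge>) l \<and> 0 \<notin> set l"

definition part :: "nat list \<Rightarrow> nat \<Rightarrow> nat" where
  "part l i = (if 1 \<le> i \<and> i \<le> length l then l ! (i - 1) else 0)"

definition diagram :: "nat list \<Rightarrow> (nat \<times> nat) set" where
  "diagram l = {(i, j). 1 \<le> i \<and> 1 \<le> j \<and> j \<le> part l i}"

definition conj_part :: "nat list \<Rightarrow> nat \<Rightarrow> nat" where
  "conj_part l j = card {i. (i, j) \<in> diagram l}"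

definition hook :: "nat list \<Rightarrow> nat \<Rightarrow> nat \<Rightarrow> nat" where
  "hook l i j = part l i - j + conj_part l j - i + 1"

definition skew :: "nat list \<Rightarrow> nat list \<Rightarrow> (nat \<times> nat) set" where
  "skew lam mu = diagram lam - diagram mu"

(* Standard increasing tableaux of shape \<lambda>/\<mu>; a tableau is a function on cells,
   normalized to 0 outside \<lambda>/\<mu>. *)
definition SIT :: "nat list \<Rightarrow> nat list \<Rightarrow> ((nat \<times> nat) \<Rightarrow> nat) set" where
  "SIT lam mu = {T.
     (\<forall>c. c \<notin> skew lam mu \<longrightarrow> T c = 0) \<and>
     (\<forall>c \<in> skew lam mu. T c \<ge> 1) \<and>
     (\<forall>i j. (i, j) \<in> skew lam mu \<and> (i, j + 1) \<in> skew lam mu \<longrightarrow> T (i, j) < T (i, j + 1)) \<and>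
     (\<forall>i j. (i, j) \<in> skew lam mu \<and> (i + 1, j) \<in> skew lam mu \<longrightarrow> T (i, j) < T (i + 1, j)) \<and>
     (\<exists>m. T ` skew lam mu = {1..m})}"

(* m(T): the largest entry (entries are exactly {1..m(T)}) *)
definition sit_max :: "nat list \<Rightarrow> nat list \<Rightarrow> ((nat \<times> nat) \<Rightarrow> nat) \<Rightarrow> nat" where
  "sit_max lam mu T = card (T ` skew lam mu)"

definition nu_diagram :: "nat list \<Rightarrow> nat list \<Rightarrow> ((nat \<times> nat) \<Rightarrow> nat) \<Rightarrow> nat \<Rightarrow> (nat \<times> nat) set" where
  "nu_diagram lam mu T k = diagram mu \<union> {c \<in> skew lam mu. T c < k}"

definition nu_part :: "nat list \<Rightarrow> nat list \<Rightarrow> ((nat \<times> nat) \<Rightarrow> nat) \<Rightarrow> nat \<Rightarrow> nat \<Rightarrow> nat" where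
  "nu_part lam mu T k i = card {j. (i, j) \<in> nu_diagram lam mu T k}"

definition active :: "nat list \<Rightarrow> (nat \<times> nat) set \<Rightarrow> nat \<Rightarrow> nat \<Rightarrow> bool" where
  "active lam S i j \<longleftrightarrow> (i, j) \<in> S \<and>
     (i + 1, j) \<in> diagram lam - S \<and> (i, j + 1) \<in> diagram lam - S \<and>
     (i + 1, j + 1) \<in> diagram lam - S"

inductive_set excited :: "nat list \<Rightarrow> nat list \<Rightarrow> (nat \<times> nat) set set"
  for lam mu where
  base: "diagram mu \<in> excited lam mu"
| move1: "S \<in> excited lam mu \<Longrightarrow> active lam S i j \<Longrightarrow>
          (S - {(i, j)}) \<union> {(i + 1, j + 1)} \<in> excited lam mu"
| move2: "S \<in> excited lam mu \<Longrightarrow> active lam S i j \<Longrightarrow>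
          S \<union> {(i + 1, j + 1)} \<in> excited lam mu"

(* Rational functions in two variables \<beta>, q over \<rat>:
   fraction field of \<rat>[q][\<beta>]. *)
type_synonym rfun = "rat poly poly fract"

definition var_beta :: rfun where
  "var_beta = Fract [:0, 1:] 1"

definition var_q :: rfun where
  "var_q = Fract [:[:0, 1:]:] 1"

end

theory Submission
  imports Defs "HOL-Computational_Algebra.Polynomial_Factorial"
begin

text \<open>
  Encode a shape \<open>\<mu>\<close> by the particle set \<open>{\<mu>\<^sub>i + d + 1 - i}\<close>. With \<open>z\<^sub>k = 1 + \<beta> q\<^sup>k\<close> and
  \<open>X\<^sub>i = z\<close> at \<open>\<lambda>\<^sub>i + d + 1 - i\<close>, \<open>Y\<^sub>j = z\<close> at \<open>d + j - \<lambda>'\<^sub>j\<close>, the weight of a cell outside \<open>D\<close> is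
  \<open>X\<^sub>i / (Y\<^sub>j - X\<^sub>i)\<close>, so up to a constant the right-hand side is the sum \<open>f(\<mu>)\<close> over \<open>D\<close> of the products of
  \<open>Y\<^sub>j / X\<^sub>i - 1\<close> over \<open>D\<close>. The generalized excited diagrams of \<open>\<lambda>/\<mu>\<close> are exactly the subwords of the row reading word
  of \<open>\<lambda>\<close> whose 0-Hecke (Demazure) product is \<open>\<mu>\<close>, where the generator at \<open>c\<close> moves a particle from \<open>c\<close> to \<open>c + 1\<close>.
  Hence \<open>f\<close> is built cell by cell, and adding a cell acts like an R-matrix that swaps two neighbouring \<open>z\<close>'s in the
  eigenvector equation
  \<open>\<Prod>\<^sub>s z\<^sub>s f(\<mu>) = \<Prod>\<^sub>i X\<^sub>i \<Sum> f(\<nu>)\<close>, with \<open>s\<close> over the particles of \<open>\<mu>\<close> and \<open>\<nu>\<close> over all shapes obtained by adding a set of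
  corners to \<open>\<mu>\<close>. Peeling off the entries 1 of a tableau gives the same recursion for the left-hand side.
\<close>

section \<open>The 0-Hecke action on particle sets, subword sums, and an eigenvector equation that
  survives adding a letter\<close>

section \<open>Demazure products and the eigenvector equation\<close>

text \<open>The action of a 0-Hecke generator on Grassmannian permutations, encoded by particle
  sets. \<open>None\<close> marks a product that leaves this class: the sites \<open>c\<close> and
  \<open>Suc c\<close> are both occupied or both empty.\<close>

definition hecke :: "nat \<Rightarrow> nat set \<Rightarrow> nat set option" where
  "hecke c S = (if c \<in> S \<and> Suc c \<notin> S then Some (insert (Suc c) (S - {c}))
     else if c \<notin> S \<and> Suc c \<in> S then Some S else None)"

text \<open>The two possible preimages, \<open>S\<close> itself by idempotence and the state before
  the hop, produce the two terms of the recursion \<open>subword_sum_snoc\<close>.\<close>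

lemma hecke_eq_Some_iff:
  "hecke c V = Some S \<longleftrightarrow>
     c \<notin> S \<and> Suc c \<in> S \<and> (V = S \<or> V = insert c (S - {Suc c}))"
  unfolding hecke_def by (auto split: if_splits)

lemma hecke_idem: "Option.bind (Option.bind s (hecke c)) (hecke c) = Option.bind s (hecke c)"
  by (cases s) (auto simp: hecke_def)

text \<open>Sites at distance at least two act on disjoint pairs of positions.\<close>

lemma hecke_commute:
  assumes "Suc c < e \<or> Suc e < c"
  shows "Option.bind (Option.bind s (hecke c)) (hecke e) = Option.bind (Option.bind s (hecke e)) (hecke c)"
  using assms by (cases s) (auto simp: hecke_def insert_commute)

text \<open>The site of a cell is its content shifted by \<open>d\<close>, so cells on one diagonal
  use the same generator.\<close>

definition step :: "nat \<Rightarrow> (nat \<times> nat) set \<Rightarrow> nat \<times> nat \<Rightarrow> nat set option \<Rightarrow> nat set option" where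
  "step d D x s = (if x \<in> D then Option.bind s (hecke (d + snd x - fst x)) else s)"

text \<open>The start \<open>{1..d}\<close> is the particle set of the empty partition.\<close>

definition demazure :: "nat \<Rightarrow> (nat \<times> nat) set \<Rightarrow> (nat \<times> nat) list \<Rightarrow> nat set option" where
  "demazure d D xs = fold (step d D) xs (Some {1..d})"

lemma demazure_Nil [simp]: "demazure d D [] = Some {1..d}"
  by (simp add: demazure_def)

lemma demazure_snoc [simp]: "demazure d D (xs @ [x]) = step d D x (demazure d D xs)"
  by (simp add: demazure_def)

lemma fold_step_cong:
  assumes "\<And>x. x \<in> set xs \<Longrightarrow> x \<in> D \<longleftrightarrow> x \<in> D'"
  shows "fold (step d D) xs s = fold (step d D') xs s"
  using assms by (intro fold_cong) (auto simp: step_def fun_eq_iff)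

lemma demazure_cong:
  assumes "\<And>x. x \<in> set xs \<Longrightarrow> x \<in> D \<longleftrightarrow> x \<in> D'"
  shows "demazure d D xs = demazure d D' xs"
  unfolding demazure_def by (rule fold_step_cong[OF assms])

lemma fold_step_None [simp]: "fold (step d D) xs None = None"
  by (induction xs) (auto simp: step_def)

lemma demazure_prefix:
  assumes "demazure d D (xs @ ys) = Some S"
  obtains V where "demazure d D xs = Some V"
  using assms by (cases "demazure d D xs") (auto simp: demazure_def)

lemma fold_step_commute:
  assumes "\<And>x. x \<in> set xs \<Longrightarrow> x \<in> D \<Longrightarrow>
    Suc c < d + snd x - fst x \<or> Suc (d + snd x - fst x) < c"
  shows "fold (step d D) xs (Option.bind s (hecke c)) = Option.bind (fold (step d D) xs s) (hecke c)"
  using assms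
proof (induction xs arbitrary: s)
  case (Cons x xs)
  have "step d D x (Option.bind s (hecke c)) = Option.bind (step d D x s) (hecke c)"
    using Cons.prems[of x] hecke_commute[of c "d + snd x - fst x" s] by (auto simp: step_def)
  then show ?case using Cons by simp
qed simp

section \<open>Weighted sums over subwords with prescribed Demazure product\<close>

definition subword_sum :: "nat \<Rightarrow> (nat \<times> nat \<Rightarrow> 'a::field) \<Rightarrow> (nat \<times> nat) list \<Rightarrow> nat set \<Rightarrow> 'a" where
  "subword_sum d p xs S = (\<Sum>D | D \<subseteq> set xs \<and> demazure d D xs = Some S. \<Prod>x\<in>D. p x)"

lemma subword_sum_Nil: "subword_sum d p [] S = (if S = {1..d} then 1 else 0)"
proof -
  have "{D. D \<subseteq> set [] \<and> demazure d D [] = Some S} = (if S = {1..d} then {{}} else {})"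
    by auto
  then show ?thesis by (simp add: subword_sum_def)
qed

text \<open>The last letter is either skipped, or used after a prefix whose product is one of the
  two preimages of \<open>S\<close> under the generator at \<open>c\<close>.\<close>

lemma subword_sum_snoc:
  assumes x: "x \<notin> set xs" and c: "c = d + snd x - fst x"
  shows "subword_sum d p (xs @ [x]) S = subword_sum d p xs S +
    (if c \<notin> S \<and> Suc c \<in> S
     then p x * (subword_sum d p xs S + subword_sum d p xs (insert c (S - {Suc c}))) else 0)"
proof -
  define A where "A V = {D. D \<subseteq> set xs \<and> demazure d D xs = Some V}" for V
  define S' where "S' = insert c (S - {Suc c})"
  define B where "B = (if c \<notin> S \<and> Suc c \<in> S then A S \<union> A S' else {})"
  have fin: "finite (A V)" for V unfolding A_def by simp
  have ins: "demazure d (insert x D) xs = demazure d D xs" for D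
    by (rule demazure_cong) (use x in auto)
  have *: "D \<subseteq> set (xs @ [x]) \<and> demazure d D (xs @ [x]) = Some S \<longleftrightarrow> D \<in> A S \<union> insert x ` B" for D
  proof (cases "x \<in> D")
    case False
    then have "D \<notin> insert x ` B" by auto
    then show ?thesis using False by (auto simp: A_def step_def)
  next
    case True
    define E where "E = D - {x}"
    have D: "D = insert x E" "x \<notin> E" using True by (auto simp: E_def)
    have nB: "D' \<in> B \<Longrightarrow> x \<notin> D'" for D' using x by (auto simp: B_def A_def split: if_splits)
    have "D \<notin> A S" using True x by (auto simp: A_def)
    moreover have "D \<in> insert x ` B \<longleftrightarrow> E \<in> B"
    proof
      assume "D \<in> insert x ` B"
      then obtain F where "F \<in> B" "D = insert x F" by blast
      moreover from this have "F = E" using nB[of F] by (auto simp: E_def)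
      ultimately show "E \<in> B" by simp
    qed (use D in blast)
    moreover have "D \<subseteq> set (xs @ [x]) \<longleftrightarrow> E \<subseteq> set xs" using D by auto
    moreover have "demazure d D (xs @ [x]) = Some S \<longleftrightarrow>
        (\<exists>V. demazure d E xs = Some V \<and> hecke c V = Some S)"
      using D by (simp add: step_def ins c bind_eq_Some_conv)
    ultimately show ?thesis
      unfolding B_def A_def S'_def hecke_eq_Some_iff by auto
  qed
  have disj: "A S \<inter> insert x ` B = {}" using x by (auto simp: A_def)
  have finB: "finite B" using fin by (simp add: B_def)
  have nB: "D \<in> B \<Longrightarrow> x \<notin> D \<and> finite D" for D
    using x by (auto simp: B_def A_def finite_subset split: if_splits)
  have inj: "inj_on (insert x) B" using nB by (auto simp: inj_on_def insert_ident)
  have "subword_sum d p (xs @ [x]) S = (\<Sum>D\<in>A S \<union> insert x ` B. \<Prod>x\<in>D. p x)"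
    unfolding subword_sum_def by (rule sum.cong) (use * in auto)
  also have "\<dots> = (\<Sum>D\<in>A S. \<Prod>x\<in>D. p x) + (\<Sum>D\<in>B. \<Prod>x\<in>insert x D. p x)"
    by (subst sum.union_disjoint) (use fin finB disj in \<open>auto simp: sum.reindex[OF inj]\<close>)
  also have "(\<Sum>D\<in>B. \<Prod>x\<in>insert x D. p x) = p x * (\<Sum>D\<in>B. \<Prod>x\<in>D. p x)"
    using nB by (auto simp: sum_distrib_left intro!: sum.cong)
  also have "(\<Sum>D\<in>B. \<Prod>x\<in>D. p x) = (if c \<notin> S \<and> Suc c \<in> S then subword_sum d p xs S + subword_sum d p xs S' else 0)"
  proof (cases "c \<notin> S \<and> Suc c \<in> S")
    case True
    then have "S \<noteq> S'" by (auto simp: S'_def)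
    then have "A S \<inter> A S' = {}" by (auto simp: A_def)
    then have "(\<Sum>D\<in>A S \<union> A S'. \<Prod>x\<in>D. p x) = (\<Sum>D\<in>A S. \<Prod>x\<in>D. p x) + (\<Sum>D\<in>A S'. \<Prod>x\<in>D. p x)"
      by (intro sum.union_disjoint fin)
    with True show ?thesis by (simp add: B_def subword_sum_def A_def)
  qed (auto simp: B_def)
  finally show ?thesis by (auto simp: subword_sum_def A_def S'_def)
qed

section \<open>Simultaneous hops of particles and the eigenvector equation\<close>

definition hoppable :: "nat set \<Rightarrow> nat set" where
  "hoppable S = {m \<in> S. Suc m \<notin> S}"

definition hop :: "nat set \<Rightarrow> nat set \<Rightarrow> nat set" where
  "hop S H = (S - H) \<union> Suc ` H"

text \<open>The sum over hop sets is the particle form of adding an arbitrary set of corners. Site 0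
  is excluded because a particle there could hop into the ground state \<open>{1..d}\<close>, which
  would break \<open>eigen_ground\<close>.\<close>

definition eigen :: "'a::field \<Rightarrow> (nat \<Rightarrow> 'a) \<Rightarrow> (nat set \<Rightarrow> 'a) \<Rightarrow> bool" where
  "eigen E z f \<longleftrightarrow> (\<forall>S. finite S \<and> 0 \<notin> S \<longrightarrow>
     (\<Prod>m\<in>S. z m) * f S = E * (\<Sum>H\<in>Pow (hoppable S). f (hop S H)))"

text \<open>A nonempty set of hops leaves a hole directly behind a particle, at its smallest site,
  which is at least 1. Hence only \<open>H = {}\<close> can produce \<open>{1..d}\<close>.\<close>

lemma eigen_ground:
  assumes "E = (\<Prod>m=1..d. z m)"
  shows "eigen E z (\<lambda>S. if S = {1..d} then 1 else 0)"
  unfolding eigen_def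
proof (intro allI impI)
  fix S :: "nat set"
  assume S: "finite S \<and> 0 \<notin> S"
  have fin: "finite (hoppable S)" using S by (simp add: hoppable_def)
  have *: "hop S H = {1..d} \<longleftrightarrow> H = {} \<and> S = {1..d}" if "H \<subseteq> hoppable S" for H
  proof
    assume h: "hop S H = {1..d}"
    have "H = {}"
    proof (rule ccontr)
      assume ne: "H \<noteq> {}"
      define m where "m = Min H"
      have fH: "finite H" using that fin finite_subset by blast
      have m: "m \<in> H" and le: "\<And>k. k \<in> H \<Longrightarrow> m \<le> k" using ne fH by (auto simp: m_def)
      have "m \<notin> hop S H" using m le by (force simp: hop_def)
      moreover have "Suc m \<in> hop S H" using m by (simp add: hop_def)
      moreover have "m \<in> S" using m that by (auto simp: hoppable_def)
      ultimately show False using h S by (cases m) auto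
    qed
    then show "H = {} \<and> S = {1..d}" using h by (simp add: hop_def)
  qed (simp add: hop_def)
  have "(\<Sum>H\<in>Pow (hoppable S). if hop S H = {1..d} then 1 else (0::'a))
      = (\<Sum>H\<in>Pow (hoppable S). if H = {} then (if S = {1..d} then 1 else 0) else 0)"
    by (rule sum.cong) (use * in auto)
  also have "\<dots> = (if S = {1..d} then 1 else 0)" using fin by (subst sum.delta) auto
  finally show "(\<Prod>m\<in>S. z m) * (if S = {1..d} then 1 else 0) =
      E * (\<Sum>H\<in>Pow (hoppable S). if hop S H = {1..d} then 1 else 0)"
    using assms by simp
qed

lemma sum_Pow_insert:
  assumes "finite A" "x \<notin> A"
  shows "(\<Sum>H\<in>Pow (insert x A). g H) = (\<Sum>H\<in>Pow A. g H + g (insert x H) :: 'a::comm_monoid_add)"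
proof -
  have "(\<Sum>H\<in>Pow (insert x A). g H) = (\<Sum>H\<in>Pow A. g H) + (\<Sum>H\<in>insert x ` Pow A. g H)"
    unfolding Pow_insert using assms by (intro sum.union_disjoint) auto
  moreover have "inj_on (insert x) (Pow A)" using assms by (auto simp: inj_on_def)
  ultimately show ?thesis by (simp add: sum.reindex sum.distrib)
qed

text \<open>One more letter at site \<open>c\<close> is compensated by exchanging the parameters at
  \<open>c\<close> and \<open>Suc c\<close>. The hypothesis on \<open>p\<close> is
  \<open>p = z c / z (Suc c) - 1\<close> cleared of its denominator. Only the occupation of these
  two sites matters, which gives three cases.\<close>

lemma eigen_swap:
  fixes f :: "nat set \<Rightarrow> 'a::field"
  assumes eig: "eigen E z' f" and c: "c \<ge> 1"
    and z': "z' c = z (Suc c)" "z' (Suc c) = z c" "\<And>m. m \<noteq> c \<Longrightarrow> m \<noteq> Suc c \<Longrightarrow> z' m = z m"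
    and p: "p * z (Suc c) = z c - z (Suc c)"
    and f': "\<And>S. f' S = f S +
      (if c \<notin> S \<and> Suc c \<in> S then p * (f S + f (insert c (S - {Suc c}))) else 0)"
  shows "eigen E z f'"
  unfolding eigen_def
proof (intro allI impI)
  fix S :: "nat set"
  assume S: "finite S \<and> 0 \<notin> S"
  define Q where "Q S = (\<Sum>H\<in>Pow (hoppable S). f (hop S H))" for S
  \<comment> \<open>The hop sets after which the new letter contributes its \<open>p\<close>
    term.\<close>
  define Good where "Good = {H \<in> Pow (hoppable S). c \<notin> hop S H \<and> Suc c \<in> hop S H}"
  have fin: "finite (hoppable S)" using S by (simp add: hoppable_def)
  have Q': "(\<Sum>H\<in>Pow (hoppable S). f' (hop S H)) =
      Q S + p * (\<Sum>H\<in>Good. f (hop S H) + f (insert c (hop S H - {Suc c})))"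
  proof -
    have "(\<Sum>H\<in>Pow (hoppable S). f' (hop S H)) = Q S + (\<Sum>H\<in>Pow (hoppable S).
        if c \<notin> hop S H \<and> Suc c \<in> hop S H
        then p * (f (hop S H) + f (insert c (hop S H - {Suc c}))) else 0)"
      unfolding f' Q_def by (rule sum.distrib)
    also have "(\<Sum>H\<in>Pow (hoppable S). if c \<notin> hop S H \<and> Suc c \<in> hop S H
        then p * (f (hop S H) + f (insert c (hop S H - {Suc c}))) else 0) =
        (\<Sum>H\<in>Good. p * (f (hop S H) + f (insert c (hop S H - {Suc c}))))"
      unfolding Good_def by (rule sum.inter_filter[symmetric]) (use fin in simp)
    finally show ?thesis by (simp only: sum_distrib_left)
  qed
  define S0 where "S0 = S - {c, Suc c}"
  define P where "P = (\<Prod>m\<in>S0. z m)"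
  have finS0: "finite S0" "c \<notin> S0" "Suc c \<notin> S0" using S by (auto simp: S0_def)
  have P': "(\<Prod>m\<in>S0. z' m) = P"
    unfolding P_def by (rule prod.cong) (auto simp: S0_def z')
  have E: "(\<Prod>m\<in>S. z' m) * f S = E * Q S" if "finite S" "0 \<notin> S" for S
    using eig that unfolding eigen_def Q_def by blast
  consider "c \<in> S \<longleftrightarrow> Suc c \<in> S" | "c \<in> S" "Suc c \<notin> S" | "c \<notin> S" "Suc c \<in> S" by blast
  then show "(\<Prod>m\<in>S. z m) * f' S = E * (\<Sum>H\<in>Pow (hoppable S). f' (hop S H))"
  proof cases
    \<comment> \<open>Equal occupation of both sites: no hop set leaves \<open>c\<close> empty and
      \<open>Suc c\<close> occupied, and the swap does not change the product of the
      parameters.\<close>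
    case 1
    have "Good = {}" using 1 by (auto simp: Good_def hop_def hoppable_def)
    moreover have "(\<Prod>m\<in>S. z m) = (\<Prod>m\<in>S. z' m)"
    proof (cases "c \<in> S")
      case True
      then have "S = insert c (insert (Suc c) S0)" using 1 by (auto simp: S0_def)
      then show ?thesis using finS0 P' by (simp add: z' P_def)
    next
      case False
      then have "S = S0" using 1 by (auto simp: S0_def)
      then show ?thesis using P' by (simp add: P_def)
    qed
    moreover have "f' S = f S" using 1 by (auto simp: f')
    ultimately show ?thesis using Q' E[of S] S by simp
  next
    \<comment> \<open>Here a hop set is good iff it contains \<open>c\<close>. Pairing
      \<open>H\<close> with \<open>insert c H\<close> turns the correction into
      \<open>p * Q S\<close>, so both sides are multiplied by \<open>1 + p\<close>.\<close>
    case 2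
    define A where "A = hoppable S - {c}"
    have hA: "hoppable S = insert c A" "c \<notin> A" "finite A"
      using 2 fin by (auto simp: A_def hoppable_def)
    have nA: "Suc c \<notin> A" "c \<notin> Suc ` A" using 2 by (auto simp: A_def hoppable_def)
    have Good: "Good = insert c ` Pow A"
    proof -
      have "H \<in> Good \<longleftrightarrow> H \<subseteq> insert c A \<and> c \<in> H" for H
        using 2 nA unfolding Good_def hA(1) by (auto simp: hop_def)
      moreover have "H \<subseteq> insert c A \<and> c \<in> H \<longleftrightarrow> H \<in> insert c ` Pow A" for H
        using hA(2) by (auto simp: image_iff intro!: bexI[of _ "H - {c}"])
      ultimately show ?thesis by (intro set_eqI) simp
    qed
    have inj: "inj_on (insert c) (Pow A)" using hA(2) by (auto simp: inj_on_def)
    have "(\<Sum>H\<in>Good. f (hop S H) + f (insert c (hop S H - {Suc c})))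
        = (\<Sum>H\<in>Pow A. f (hop S (insert c H)) + f (hop S H))"
      unfolding Good sum.reindex[OF inj] o_def
    proof (rule sum.cong[OF refl])
      fix H assume H: "H \<in> Pow A"
      have "insert c (hop S (insert c H) - {Suc c}) = hop S H"
        using H 2 nA hA(2) by (auto simp: hop_def)
      then show "f (hop S (insert c H)) + f (insert c (hop S (insert c H) - {Suc c}))
          = f (hop S (insert c H)) + f (hop S H)" by simp
    qed
    also have "\<dots> = Q S"
      unfolding Q_def hA(1) using hA by (subst sum_Pow_insert) (auto simp: add.commute)
    finally have Q2: "(\<Sum>H\<in>Pow (hoppable S). f' (hop S H)) = Q S + p * Q S" using Q' by simp
    have "S = insert c S0" using 2 by (auto simp: S0_def)
    then have pz: "(\<Prod>m\<in>S. z m) = z c * P" "(\<Prod>m\<in>S. z' m) = z (Suc c) * P"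
      using finS0 P' by (simp_all add: z' P_def)
    have "z c = (1 + p) * z (Suc c)" using p by (simp add: algebra_simps)
    then have "(\<Prod>m\<in>S. z m) * f' S = (1 + p) * ((\<Prod>m\<in>S. z' m) * f S)"
      using pz 2 by (simp add: f')
    also have "\<dots> = E * (Q S + p * Q S)" using E[of S] S by (simp add: algebra_simps)
    finally show ?thesis using Q2 by simp
  next
    \<comment> \<open>Good hop sets avoid \<open>c - 1\<close>, which would fill \<open>c\<close>,
      and \<open>Suc c\<close>, which would move away. They are the hop sets of \<open>S'\<close>
      without \<open>c\<close>; the moved-back terms and the original ones together give all of
      \<open>Q S'\<close>.\<close>
    case 3
    define A where "A = hoppable S - {c - 1, Suc c}"
    define S' where "S' = insert c (S - {Suc c})"
    have S'fin: "finite S'" "0 \<notin> S'" using S c by (auto simp: S'_def)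
    have hA: "hoppable S' = insert c A"
      using 3 c by (auto simp: A_def hoppable_def S'_def)
    have nA: "c \<notin> A" "Suc c \<notin> A" "c \<notin> Suc ` A" "finite A"
      using 3 fin by (auto simp: A_def hoppable_def)
    have AS: "A \<subseteq> S" by (auto simp: A_def hoppable_def)
    have Good: "Good = Pow A"
    proof -
      have "H \<in> Good \<longleftrightarrow> H \<subseteq> hoppable S \<and> c - 1 \<notin> H \<and> Suc c \<notin> H" for H
      proof -
        have "c \<in> Suc ` H \<longleftrightarrow> c - 1 \<in> H" using c by (cases c) auto
        moreover have "H \<subseteq> hoppable S \<Longrightarrow> Suc c \<notin> Suc ` H" using 3 by (auto simp: hoppable_def)
        ultimately show ?thesis unfolding Good_def hop_def using 3 by auto
      qed
      then show ?thesis by (auto simp: A_def)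
    qed
    have "(\<Sum>H\<in>Good. f (hop S H) + f (insert c (hop S H - {Suc c})))
        = (\<Sum>H\<in>Pow A. f (hop S' H) + f (hop S' (insert c H)))"
      unfolding Good
    proof (rule sum.cong[OF refl])
      fix H assume H: "H \<in> Pow A"
      have "hop S' H = insert c (hop S H - {Suc c})" "hop S' (insert c H) = hop S H"
        using H 3 nA AS by (auto simp: hop_def S'_def)
      then show "f (hop S H) + f (insert c (hop S H - {Suc c}))
          = f (hop S' H) + f (hop S' (insert c H))" by (simp add: add.commute)
    qed
    also have "\<dots> = Q S'"
      unfolding Q_def hA using nA by (subst sum_Pow_insert) auto
    finally have Q2: "(\<Sum>H\<in>Pow (hoppable S). f' (hop S H)) = Q S + p * Q S'" using Q' by simp
    have "S = insert (Suc c) S0" "S' = insert c S0" using 3 by (auto simp: S0_def S'_def)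
    then have pz: "(\<Prod>m\<in>S. z m) = z (Suc c) * P" "(\<Prod>m\<in>S. z' m) = z c * P"
        "(\<Prod>m\<in>S'. z' m) = z (Suc c) * P"
      using finS0 P' by (simp_all add: z' P_def)
    have "(\<Prod>m\<in>S. z m) * f' S = (z (Suc c) + p * z (Suc c)) * P * f S + p * (z (Suc c) * P * f S')"
      using 3 pz by (simp add: f' S'_def algebra_simps)
    also have "\<dots> = (\<Prod>m\<in>S. z' m) * f S + p * ((\<Prod>m\<in>S'. z' m) * f S')"
      using pz p by simp
    also have "\<dots> = E * (Q S + p * Q S')"
      using E[of S] E[of S'] S S'fin by (simp add: algebra_simps)
    finally show ?thesis using Q2 by simp
  qed
qed

section \<open>Partitions as functions, prefixes of the row reading word, and particle sets\<close>

section \<open>Shapes and reading words\<close>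

text \<open>Index 0 is pinned to 0, as in \<open>part\<close>, so that equal partitions are equal
  functions.\<close>

definition shape :: "nat \<Rightarrow> (nat \<Rightarrow> nat) \<Rightarrow> bool" where
  "shape d m \<longleftrightarrow> m 0 = 0 \<and> (\<forall>i\<ge>1. m (Suc i) \<le> m i) \<and> (\<forall>i>d. m i = 0)"

definition cells_of :: "(nat \<Rightarrow> nat) \<Rightarrow> (nat \<times> nat) set" where
  "cells_of m = {(i, j). 1 \<le> i \<and> 1 \<le> j \<and> j \<le> m i}"

definition particles :: "nat \<Rightarrow> (nat \<Rightarrow> nat) \<Rightarrow> nat set" where
  "particles d m = (\<lambda>i. m i + d + 1 - i) ` {1..d}"

text \<open>The partial shape covered by the prefix \<open>reading_word l a b\<close>; the pair
  \<open>a\<close>, \<open>b\<close> serves as the clock of all inductions along the word.\<close>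

definition stage :: "(nat \<Rightarrow> nat) \<Rightarrow> nat \<Rightarrow> nat \<Rightarrow> nat \<Rightarrow> nat" where
  "stage l a b i = (if i < a then l i else if i = a then b else 0)"

definition reading_word :: "(nat \<Rightarrow> nat) \<Rightarrow> nat \<Rightarrow> nat \<Rightarrow> (nat \<times> nat) list" where
  "reading_word l a b = concat (map (\<lambda>i. map (Pair i) [1..<Suc (l i)]) [1..<a]) @ map (Pair a) [1..<Suc b]"

lemma mem_cells_of [simp]: "(i, j) \<in> cells_of m \<longleftrightarrow> 1 \<le> i \<and> 1 \<le> j \<and> j \<le> m i"
  by (simp add: cells_of_def)

lemma finite_cells_of:
  assumes "shape d m" shows "finite (cells_of m)"
proof -
  have "cells_of m \<subseteq> (SIGMA i:{..d}. {..m i})"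
  proof (clarsimp simp: cells_of_def)
    fix i j assume "Suc 0 \<le> j" "j \<le> m i"
    then show "i \<le> d" using assms by (cases "i \<le> d") (auto simp: shape_def)
  qed
  then show ?thesis by (rule finite_subset) auto
qed

lemma shape_mono:
  assumes "shape d m" "1 \<le> i" "i \<le> k"
  shows "m k \<le> m i"
  using assms(3)
proof (induction k rule: dec_induct)
  case (step n)
  then have "m (Suc n) \<le> m n" using assms by (auto simp: shape_def)
  then show ?case using step by simp
qed simp

lemma shape_stage:
  assumes "shape d l" "1 \<le> a" "a \<le> d" "b \<le> l a"
  shows "shape d (stage l a b)"
  unfolding shape_def
proof (intro conjI allI impI)
  fix i :: nat assume i: "1 \<le> i"
  have "l (Suc i) \<le> l i" using assms(1) i by (auto simp: shape_def)
  then show "stage l a b (Suc i) \<le> stage l a b i"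
    using assms by (cases "Suc i = a") (auto simp: stage_def)
qed (use assms in \<open>auto simp: stage_def shape_def\<close>)

lemma shape_Suc:
  assumes "shape d m" "1 \<le> i" "i \<le> d" "i = 1 \<or> m i < m (i - 1)"
  shows "shape d (m(i := Suc (m i)))"
  unfolding shape_def
proof (intro conjI allI impI)
  fix k :: nat assume k: "1 \<le> k"
  then have "m (Suc k) \<le> m k" using assms(1) by (auto simp: shape_def)
  then show "(m(i := Suc (m i))) (Suc k) \<le> (m(i := Suc (m i))) k"
    using assms k by (cases "Suc k = i") auto
qed (use assms in \<open>auto simp: shape_def\<close>)

lemma stage_row: "stage l (Suc a) 0 = stage l a (l a)"
  by (auto simp: stage_def fun_eq_iff)

lemma stage_full: "shape d l \<Longrightarrow> stage l d (l d) = l"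
  by (auto simp: stage_def fun_eq_iff shape_def)

lemma stage_Suc: "stage l a (Suc b) = (stage l a b)(a := Suc (stage l a b a))"
  by (auto simp: stage_def fun_eq_iff)

lemma reading_word_ground [simp]: "reading_word l 1 0 = []" "reading_word l (Suc 0) 0 = []"
  by (simp_all add: reading_word_def)

lemma reading_word_Suc: "reading_word l a (Suc b) = reading_word l a b @ [(a, Suc b)]"
  by (simp add: reading_word_def)

lemma reading_word_row: "1 \<le> a \<Longrightarrow> reading_word l (Suc a) 0 = reading_word l a (l a)"
  by (simp add: reading_word_def)

lemma set_reading_word: "1 \<le> a \<Longrightarrow> set (reading_word l a b) = cells_of (stage l a b)"
  by (auto simp: reading_word_def stage_def cells_of_def image_iff Bex_def less_Suc_eq_le
      simp del: upt_Suc split: if_splits)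

text \<open>Besides the step that appends a cell there is a change of notation: the end of row
  \<open>a\<close> and the start of row \<open>Suc a\<close> denote the same prefix, by
  \<open>reading_word_row\<close> and \<open>stage_row\<close>.\<close>

lemma reading_word_induct [consumes 3, case_names ground cell row]:
  assumes "1 \<le> a" "a \<le> d" "b \<le> l a"
    and ground: "P 1 0"
    and cell: "\<And>a b. 1 \<le> a \<Longrightarrow> a \<le> d \<Longrightarrow> b < l a \<Longrightarrow> P a b \<Longrightarrow> P a (Suc b)"
    and row: "\<And>a. 1 \<le> a \<Longrightarrow> a < d \<Longrightarrow> P a (l a) \<Longrightarrow> P (Suc a) 0"
  shows "P a b"
  using assms(1-3)
proof (induction a arbitrary: b rule: dec_induct)
  case base
  then show ?case
    by (induction b) (use ground cell in auto)
next
  case (step a)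
  from step.prems(2) show ?case
  proof (induction b)
    case 0
    show ?case using step by (intro row step.IH) auto
  next
    case (Suc b)
    then show ?case using step.prems by (intro cell) auto
  qed
qed

section \<open>Particle sets of shapes\<close>

lemma particles_less:
  assumes "shape d m" "1 \<le> i" "i < k" "k \<le> d"
  shows "m k + d + 1 - k < m i + d + 1 - i"
  using shape_mono[OF assms(1,2), of k] assms by simp

lemma inj_particles: "shape d m \<Longrightarrow> inj_on (\<lambda>i. m i + d + 1 - i) {1..d}"
proof (rule linorder_inj_onI)
  fix i k assume "shape d m" "i < k" "i \<in> {1..d}" "k \<in> {1..d}"
  then show "m i + d + 1 - i \<noteq> m k + d + 1 - k" using particles_less[of d m i k] by simp
qed auto

lemma finite_particles [simp]: "finite (particles d m)"
  by (simp add: particles_def)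

lemma zero_notin_particles: "0 \<notin> particles d m"
  by (auto simp: particles_def)

text \<open>Particle positions decrease strictly with the row index, so only the particle of row
  \<open>i - 1\<close> can sit directly to the right of that of row \<open>i\<close>, and it does so
  iff the two rows are equally long.\<close>

lemma mem_particles_iff:
  assumes "shape d m" "1 \<le> i" "i \<le> d"
  shows "Suc (m i + d + 1 - i) \<in> particles d m \<longleftrightarrow> \<not> (i = 1 \<or> m i < m (i - 1))"
proof
  assume "Suc (m i + d + 1 - i) \<in> particles d m"
  then obtain k where k: "1 \<le> k" "k \<le> d" "Suc (m i + d + 1 - i) = m k + d + 1 - k"
    by (auto simp: particles_def)
  have "k < i"
  proof (rule ccontr)
    assume "\<not> k < i"
    then show False using particles_less[OF assms(1,2), of k] k by (cases "k = i") auto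
  qed
  then have "m i \<le> m (i - 1)" "m (i - 1) \<le> m k"
    using assms k by (auto intro: shape_mono)
  then show "\<not> (i = 1 \<or> m i < m (i - 1))" using k assms \<open>k < i\<close> by auto
next
  assume a: "\<not> (i = 1 \<or> m i < m (i - 1))"
  moreover have "m i \<le> m (i - 1)" using a assms by (auto intro: shape_mono)
  ultimately have "Suc (m i + d + 1 - i) = m (i - 1) + d + 1 - (i - 1)" using assms by auto
  then show "Suc (m i + d + 1 - i) \<in> particles d m"
    unfolding particles_def by (rule image_eqI[of _ _ "i - 1"]) (use a assms in auto)
qed

lemma particles_Suc:
  assumes "shape d m" "1 \<le> i" "i \<le> d"
  shows "particles d (m(i := Suc (m i))) = insert (Suc (m i + d + 1 - i)) (particles d m - {m i + d + 1 - i})"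
proof -
  have D: "{1..d} = insert i ({1..d} - {i})" using assms by auto
  have "particles d m - {m i + d + 1 - i} = (\<lambda>i. m i + d + 1 - i) ` ({1..d} - {i})"
    unfolding particles_def using inj_on_image_set_diff[OF inj_particles[OF assms(1)], of "{1..d}" "{i}"] assms
    by auto
  moreover have "particles d (m(i := Suc (m i))) =
      insert (Suc (m i + d + 1 - i)) ((\<lambda>i. m i + d + 1 - i) ` ({1..d} - {i}))"
  proof -
    have "particles d (m(i := Suc (m i))) =
        insert (Suc (m i) + d + 1 - i) ((\<lambda>k. (m(i := Suc (m i))) k + d + 1 - k) ` ({1..d} - {i}))"
      unfolding particles_def by (subst D, subst image_insert) simp
    moreover have "(\<lambda>k. (m(i := Suc (m i))) k + d + 1 - k) ` ({1..d} - {i}) =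
        (\<lambda>k. m k + d + 1 - k) ` ({1..d} - {i})"
      by (rule image_cong) auto
    ultimately show ?thesis using assms by (simp add: Suc_diff_le)
  qed
  ultimately show ?thesis by simp
qed

lemma particles_zero:
  assumes "\<And>i. 1 \<le> i \<Longrightarrow> m i = 0"
  shows "particles d m = {1..d}"
proof -
  have "x \<in> particles d m" if "x \<in> {1..d}" for x
    unfolding particles_def using that assms by (intro image_eqI[of _ _ "d + 1 - x"]) auto
  moreover have "x \<in> {1..d}" if "x \<in> particles d m" for x
    using that assms unfolding particles_def by auto
  ultimately show ?thesis by blast
qed

text \<open>Reading the cells of \<open>m\<close> row by row adds one box at a time, always at an
  addable corner, so every letter that is used makes a genuine hop.\<close>

lemma demazure_cells_of:
  assumes "shape d l" "1 \<le> a" "a \<le> d" "b \<le> l a"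
    and "shape d m" "\<And>i. m i \<le> stage l a b i" "\<And>x. x \<in> set (reading_word l a b) \<Longrightarrow> x \<in> D \<longleftrightarrow> x \<in> cells_of m"
  shows "demazure d D (reading_word l a b) = Some (particles d m)"
  using assms(2-)
proof (induction arbitrary: m rule: reading_word_induct)
  case ground
  have "m i = 0" for i
    using ground(2)[of i] ground(1) by (cases "i = 0") (auto simp: stage_def shape_def split: if_splits)
  then show ?case by (simp add: particles_zero)
next
  case (row a)
  then show ?case by (auto simp: reading_word_row stage_row)
next
  case (cell a b)
  have mem: "(a, Suc b) \<in> D \<longleftrightarrow> Suc b \<le> m a"
    using cell.prems(3)[of "(a, Suc b)"] cell.hyps by (auto simp: reading_word_Suc)
  show ?case
  proof (cases "Suc b \<le> m a")
    case False
    have "m i \<le> stage l a b i" for i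
      using cell.prems(2)[of i] False by (auto simp: stage_def split: if_splits)
    then have "demazure d D (reading_word l a b) = Some (particles d m)"
      using cell.prems by (intro cell.IH) (auto simp: reading_word_Suc)
    then show ?thesis using False mem by (simp add: reading_word_Suc step_def)
  next
    case True
    then have ma: "m a = Suc b" using cell.prems(2)[of a] by (auto simp: stage_def)
    \<comment> \<open>The shape just before the last box of row \<open>a\<close>; it is a partition
      because row \<open>Suc a\<close> is still empty.\<close>
    define m' where "m' = m(a := b)"
    have m': "m = m'(a := Suc (m' a))" "m' a = b" by (auto simp: m'_def ma)
    have next0: "m (Suc a) = 0" using cell.prems(2)[of "Suc a"] by (simp add: stage_def)
    have shape: "shape d m'"
      unfolding shape_def
    proof (intro conjI allI impI)
      fix i :: nat assume "1 \<le> i"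
      then have "m (Suc i) \<le> m i" using cell.prems(1) by (auto simp: shape_def)
      then show "m' (Suc i) \<le> m' i" using ma next0 by (auto simp: m'_def)
    qed (use cell.prems(1) cell.hyps in \<open>auto simp: m'_def shape_def\<close>)
    have "m' i \<le> stage l a b i" for i
      using cell.prems(2)[of i] by (auto simp: stage_def m'_def split: if_splits)
    moreover have "x \<in> D \<longleftrightarrow> x \<in> cells_of m'" if "x \<in> set (reading_word l a b)" for x
    proof -
      have "x \<in> cells_of (stage l a b)" using that cell.hyps by (simp add: set_reading_word)
      moreover have "x \<in> D \<longleftrightarrow> x \<in> cells_of m" using cell.prems(3)[of x] that by (simp add: reading_word_Suc)
      ultimately show ?thesis by (cases x) (auto simp: m'_def stage_def ma split: if_splits)
    qed
    ultimately have IH: "demazure d D (reading_word l a b) = Some (particles d m')"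
      using shape by (intro cell.IH) auto
    \<comment> \<open>The site of the new cell is the position of the particle of row
      \<open>a\<close> in \<open>m'\<close>.\<close>
    have s: "d + Suc b - a = m' a + d + 1 - a" using m' by simp
    have "a = 1 \<or> m' a < m' (a - 1)"
    proof (cases "a = 1")
      case False
      then have "m a \<le> m (a - 1)" using cell.prems(1) cell.hyps by (auto intro: shape_mono)
      then show ?thesis using ma False cell.hyps by (auto simp: m'_def)
    qed simp
    then have "Suc (m' a + d + 1 - a) \<notin> particles d m'"
      using mem_particles_iff[OF shape] cell.hyps by auto
    moreover have "m' a + d + 1 - a \<in> particles d m'" using cell.hyps by (auto simp: particles_def)
    ultimately have "hecke (m' a + d + 1 - a) (particles d m') = Some (particles d m)"
      unfolding m'(1) using particles_Suc[OF shape] cell.hyps by (simp add: hecke_def)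
    then show ?thesis using IH mem True s by (simp add: reading_word_Suc step_def)
  qed
qed

text \<open>Counting the particles at or beyond \<open>t\<close> notices a hop only when it crosses
  into \<open>t\<close>.\<close>

lemma card_hop_above:
  assumes "finite S" "c \<in> S" "Suc c \<notin> S"
  shows "card {s \<in> insert (Suc c) (S - {c}). t \<le> s} =
    card {s \<in> S. t \<le> s} + (if t = Suc c then 1 else 0)"
proof -
  consider "t = Suc c" | "t \<le> c" | "t > Suc c" by linarith
  then show ?thesis
  proof cases
    case 1
    then have "{s \<in> insert (Suc c) (S - {c}). t \<le> s} = insert (Suc c) {s \<in> S. t \<le> s}" by auto
    then show ?thesis using assms 1 by simp
  next
    case 2
    then have "{s \<in> insert (Suc c) (S - {c}). t \<le> s} = insert (Suc c) ({s \<in> S. t \<le> s} - {c})" by auto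
    then have "card {s \<in> insert (Suc c) (S - {c}). t \<le> s} = Suc (card ({s \<in> S. t \<le> s} - {c}))"
      using assms by simp
    also have "\<dots> = card {s \<in> S. t \<le> s}" using assms 2 by (intro card_Suc_Diff1) auto
    finally show ?thesis using 2 by simp
  next
    case 3
    then have "{s \<in> insert (Suc c) (S - {c}). t \<le> s} = {s \<in> S. t \<le> s}" by auto
    then show ?thesis using 3 by simp
  qed
qed

text \<open>The full word hops a particle at every letter, a subword at most there. Each threshold
  count of the full word therefore grows whenever that of the subword can.\<close>

lemma demazure_dominated:
  assumes "shape d l" "1 \<le> a" "a \<le> d" "b \<le> l a"
    and "demazure d D (reading_word l a b) = Some S"
  shows "finite S \<and> (\<forall>t. card {s \<in> S. t \<le> s} \<le> card {s \<in> particles d (stage l a b). t \<le> s})"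
  using assms(2-)
proof (induction arbitrary: S rule: reading_word_induct)
  case ground
  then show ?case by (auto simp: particles_zero stage_def)
next
  case (row a)
  then show ?case by (auto simp: reading_word_row stage_row)
next
  case (cell a b)
  define c where "c = d + Suc b - a"
  have shape: "shape d (stage l a b)" using assms(1) cell by (intro shape_stage) auto
  have c: "c = stage l a b a + d + 1 - a" by (simp add: c_def stage_def)
  have "a = 1 \<or> stage l a b a < stage l a b (a - 1)"
  proof (cases "a = 1")
    case False
    then have "l a \<le> l (a - 1)" using cell.hyps(1) by (intro shape_mono[OF assms(1)]) auto
    then show ?thesis using cell.hyps(1,3) by (simp add: stage_def)
  qed simp
  then have c2: "Suc c \<notin> particles d (stage l a b)"
    unfolding c using mem_particles_iff[OF shape] cell by blast
  have c1: "c \<in> particles d (stage l a b)" unfolding c particles_def using cell by auto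
  have c3: "particles d (stage l a (Suc b)) = insert (Suc c) (particles d (stage l a b) - {c})"
    unfolding stage_Suc c by (rule particles_Suc[OF shape]) (use cell in auto)
  obtain V where V: "demazure d D (reading_word l a b) = Some V"
    using cell.prems unfolding reading_word_Suc by (rule demazure_prefix)
  have "step d D (a, Suc b) (Some V) = Some S" using cell.prems V by (simp add: reading_word_Suc)
  then have S: "S = V \<or> c \<in> V \<and> Suc c \<notin> V \<and> S = insert (Suc c) (V - {c})"
    by (auto simp: step_def c_def hecke_def split: if_splits)
  have IH: "finite V" "card {s \<in> V. t \<le> s} \<le> card {s \<in> particles d (stage l a b). t \<le> s}" for t
    using cell.IH[OF V] by auto
  show ?case
    unfolding c3 using S IH card_hop_above[OF _ c1 c2]
  proof (elim disjE)
    assume "S = V"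
    then show "finite S \<and> (\<forall>t. card {s \<in> S. t \<le> s} \<le> card {s \<in> insert (Suc c) (particles d (stage l a b) - {c}). t \<le> s})"
      using IH card_hop_above[OF _ c1 c2] by (auto intro: le_SucI)
  next
    assume s: "c \<in> V \<and> Suc c \<notin> V \<and> S = insert (Suc c) (V - {c})"
    then show "finite S \<and> (\<forall>t. card {s \<in> S. t \<le> s} \<le> card {s \<in> insert (Suc c) (particles d (stage l a b) - {c}). t \<le> s})"
      using IH card_hop_above[OF _ c1 c2] card_hop_above[of V c] by auto
  qed
qed

text \<open>If row \<open>i\<close> were longer in \<open>m\<close> than in \<open>l\<close>, then
  at or beyond the \<open>i\<close>-th particle of \<open>m\<close> there would be at least
  \<open>i\<close> particles of \<open>m\<close> but at most \<open>i - 1\<close> of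
  \<open>l\<close>.\<close>

lemma dominated_imp_le:
  assumes m: "shape d m" and l: "shape d l"
    and dom: "\<And>t. card {s \<in> particles d m. t \<le> s} \<le> card {s \<in> particles d l. t \<le> s}"
  shows "m i \<le> l i"
proof (rule ccontr)
  assume "\<not> m i \<le> l i"
  then have lt: "l i < m i" by simp
  then have i: "1 \<le> i" "i \<le> d" using m by (auto simp: shape_def Suc_le_eq intro: ccontr)
  define t where "t = m i + d + 1 - i"
  have "(\<lambda>i. m i + d + 1 - i) ` {1..i} \<subseteq> {s \<in> particles d m. t \<le> s}"
  proof -
    have "t \<le> m k + d + 1 - k" if "1 \<le> k" "k \<le> i" for k
      using particles_less[OF m, of k i] that i by (cases "k = i") (auto simp: t_def)
    then show ?thesis using i by (auto simp: particles_def)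
  qed
  then have "card ((\<lambda>i. m i + d + 1 - i) ` {1..i}) \<le> card {s \<in> particles d m. t \<le> s}"
    by (intro card_mono) auto
  moreover have "card ((\<lambda>i. m i + d + 1 - i) ` {1..i}) = i"
    using inj_on_subset[OF inj_particles[OF m], of "{1..i}"] i by (subst card_image) auto
  moreover have "{s \<in> particles d l. t \<le> s} \<subseteq> (\<lambda>i. l i + d + 1 - i) ` {1..<i}"
  proof
    fix s assume "s \<in> {s \<in> particles d l. t \<le> s}"
    then obtain k where k: "1 \<le> k" "k \<le> d" "s = l k + d + 1 - k" "t \<le> s" by (auto simp: particles_def)
    have "k < i"
    proof (rule ccontr)
      assume "\<not> k < i"
      then have "l k + d + 1 - k \<le> l i + d + 1 - i"
        using particles_less[OF l, of i k] i k by (cases "k = i") auto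
      then show False using lt i k by (auto simp: t_def)
    qed
    then show "s \<in> (\<lambda>i. l i + d + 1 - i) ` {1..<i}" using k by auto
  qed
  then have "card {s \<in> particles d l. t \<le> s} \<le> card ((\<lambda>i. l i + d + 1 - i) ` {1..<i})"
    by (intro card_mono) auto
  moreover have "card ((\<lambda>i. l i + d + 1 - i) ` {1..<i}) \<le> i - 1"
    using card_image_le[of "{1..<i}" "\<lambda>i. l i + d + 1 - i"] by simp
  ultimately show False using dom[of t] i by linarith
qed

lemma particles_inject:
  assumes "shape d m" "shape d l" "particles d m = particles d l"
  shows "m = l"
  using dominated_imp_le[of d m l] dominated_imp_le[of d l m] assms by (auto simp: fun_eq_iff intro: antisym)

section \<open>Excited moves preserve Demazure products and can be undone down to a straight
  shape\<close>

section \<open>Excited diagrams as Demazure subwords\<close>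

lemma upt_split:
  assumes "1 \<le> j" "j \<le> n"
  shows "[1..<Suc n] = [1..<j] @ j # [Suc j..<Suc n]"
  using assms upt_add_eq_append[of 1 j "Suc n - j"] by (simp add: upt_conv_Cons del: upt_Suc)

lemma reading_word_split:
  assumes "shape d l" "1 \<le> i" "1 \<le> j" "(Suc i, Suc j) \<in> cells_of l"
  obtains P M R where "reading_word l d (l d) = P @ [(i, j)] @ M @ [(Suc i, Suc j)] @ R"
    "\<And>x. x \<in> set M \<Longrightarrow> (\<exists>k>j. x = (i, k)) \<or> (\<exists>k\<le>j. x = (Suc i, k))"
proof -
  define row where "row = (\<lambda>k. map (Pair k) [1..<Suc (l k)])"
  have i: "Suc i \<le> d" using assms by (auto simp: shape_def intro: ccontr)
  have j: "j \<le> l i" using assms shape_mono[of d l i "Suc i"] by auto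
  have "[1..<Suc d] = [1..<i] @ [i, Suc i] @ [Suc (Suc i)..<Suc d]"
    using upt_split[of i d] i assms(2) by (simp add: upt_conv_Cons del: upt_Suc)
  moreover have "reading_word l d (l d) = concat (map row [1..<Suc d])"
    using i by (simp add: reading_word_def row_def upt_Suc_append[of "Suc 0" d] del: upt_Suc)
  moreover have "row i = map (Pair i) [1..<j] @ (i, j) # map (Pair i) [Suc j..<Suc (l i)]"
    unfolding row_def using upt_split[of j "l i"] j assms(3) by (simp del: upt_Suc)
  moreover have "row (Suc i) = map (Pair (Suc i)) [1..<Suc j] @ (Suc i, Suc j) #
      map (Pair (Suc i)) [Suc (Suc j)..<Suc (l (Suc i))]"
    unfolding row_def using upt_split[of "Suc j" "l (Suc i)"] assms(4) by (simp del: upt_Suc)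
  ultimately have "reading_word l d (l d) = (concat (map row [1..<i]) @ map (Pair i) [1..<j]) @ [(i, j)] @
     (map (Pair i) [Suc j..<Suc (l i)] @ map (Pair (Suc i)) [1..<Suc j]) @ [(Suc i, Suc j)] @
     (map (Pair (Suc i)) [Suc (Suc j)..<Suc (l (Suc i))] @ concat (map row [Suc (Suc i)..<Suc d]))"
    by (simp del: upt_Suc)
  then show ?thesis
    by (rule that) (auto simp del: upt_Suc)
qed

lemma distinct_reading_word: "distinct (reading_word l a b)"
proof -
  have "distinct (concat (map (\<lambda>i. map (Pair i) [1..<Suc (l i)]) [1..<a]))"
  proof (induction a)
    case (Suc a)
    then show ?case
      by (cases "a = 0") (auto simp: distinct_map inj_on_def upt_Suc_append simp del: upt_Suc)
  qed simp
  then show ?thesis by (auto simp: reading_word_def distinct_map inj_on_def simp del: upt_Suc)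
qed

text \<open>Both cells of the move carry the same generator. Among the cells read between them, the
  two with neighbouring sites, \<open>(i, Suc j)\<close> and \<open>(Suc i, j)\<close>, are not in
  \<open>D\<close>, so the generator commutes past the rest. A type I move slides it; a type II move
  repeats it, which idempotence makes harmless.\<close>

lemma demazure_move:
  assumes "shape d l" "1 \<le> i" "1 \<le> j" "(Suc i, Suc j) \<in> cells_of l"
    and D: "(i, j) \<in> D" "(Suc i, j) \<notin> D" "(i, Suc j) \<notin> D" "(Suc i, Suc j) \<notin> D"
  shows "demazure d (D - {(i, j)} \<union> {(Suc i, Suc j)}) (reading_word l d (l d)) = demazure d D (reading_word l d (l d))"
    and "demazure d (D \<union> {(Suc i, Suc j)}) (reading_word l d (l d)) = demazure d D (reading_word l d (l d))"
proof -
  obtain P M R where dec: "reading_word l d (l d) = P @ [(i, j)] @ M @ [(Suc i, Suc j)] @ R"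
    and M: "\<And>x. x \<in> set M \<Longrightarrow> (\<exists>k>j. x = (i, k)) \<or> (\<exists>k\<le>j. x = (Suc i, k))"
    using reading_word_split[OF assms(1-4)] by metis
  have i: "Suc i \<le> d" using assms by (auto simp: shape_def intro: ccontr)
  define c where "c = d + j - i"
  define x where "x = (i, j)"
  define y where "y = (Suc i, Suc j)"
  have dist: "distinct (P @ [x] @ M @ [y] @ R)"
    using distinct_reading_word[of l d "l d"] unfolding dec x_def y_def .
  have far: "Suc c < d + snd u - fst u \<or> Suc (d + snd u - fst u) < c"
    if u: "u \<in> set M" "u \<in> D" for u
    using M[OF u(1)]
  proof (elim disjE exE conjE)
    fix k assume k: "k > j" "u = (i, k)"
    then have "k \<noteq> Suc j" using u D by auto
    then show ?thesis using k(1) i unfolding k(2) c_def fst_conv snd_conv by arith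
  next
    fix k assume k: "k \<le> j" "u = (Suc i, k)"
    then have "k \<noteq> j" using u D by auto
    then show ?thesis using k(1) i unfolding k(2) c_def fst_conv snd_conv by arith
  qed
  define s where "s = fold (step d D) P (Some {1..d})"
  \<comment> \<open>Changing \<open>D\<close> only at \<open>x\<close> and \<open>y\<close> does not
    affect the letters before, between and after them.\<close>
  have s: "fold (step d D') P (Some {1..d}) = s" if "D' - {x, y} = D - {x, y}" for D'
    unfolding s_def by (rule fold_step_cong) (use that dist in auto)
  have m: "fold (step d D') M t = fold (step d D) M t" if "D' - {x, y} = D - {x, y}" for D' t
    by (rule fold_step_cong) (use that dist in auto)
  have r: "fold (step d D') R t = fold (step d D) R t" if "D' - {x, y} = D - {x, y}" for D' t
    by (rule fold_step_cong) (use that dist in auto)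
  have xy: "step d D' x t = (if x \<in> D' then Option.bind t (hecke c) else t)"
    "step d D' y t = (if y \<in> D' then Option.bind t (hecke c) else t)" for D' t
    by (simp_all add: step_def x_def y_def c_def)
  have com: "fold (step d D) M (Option.bind t (hecke c)) = Option.bind (fold (step d D) M t) (hecke c)" for t
    by (rule fold_step_commute) (rule far)
  have ne: "x \<noteq> y" and xD: "x \<in> D" "y \<notin> D" using D by (auto simp: x_def y_def)
  have eq: "demazure d D' (reading_word l d (l d)) =
      fold (step d D) R (step d D' y (fold (step d D) M (step d D' x s)))"
    if "D' - {x, y} = D - {x, y}" for D'
    unfolding dec demazure_def x_def[symmetric] y_def[symmetric] by (simp add: s[OF that] m[OF that] r[OF that] del: One_nat_def)
  have "demazure d (D - {x} \<union> {y}) (reading_word l d (l d)) = demazure d D (reading_word l d (l d))"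
    by (subst (1 2) eq) (use ne xD in \<open>auto simp: xy com\<close>)
  then show "demazure d (D - {(i, j)} \<union> {(Suc i, Suc j)}) (reading_word l d (l d)) = demazure d D (reading_word l d (l d))"
    by (simp only: x_def y_def)
  have "demazure d (D \<union> {y}) (reading_word l d (l d)) = demazure d D (reading_word l d (l d))"
    by (subst (1 2) eq) (use ne xD in \<open>auto simp: xy com hecke_idem simp del: Option.bind_assoc\<close>)
  then show "demazure d (D \<union> {(Suc i, Suc j)}) (reading_word l d (l d)) = demazure d D (reading_word l d (l d))"
    by (simp only: y_def)
qed

text \<open>Along the word, the cells of \<open>D\<close> read so far form the diagram of some
  \<open>m\<close>. A further cell of \<open>D\<close> that is not a corner of \<open>m\<close>
  either makes the product undefined or exposes a reverse move.\<close>

lemma cells_of_or_reverse_move: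
  assumes l: "shape d l" and d: "1 \<le> d" and D: "D \<subseteq> cells_of l"
    and dem: "demazure d D (reading_word l d (l d)) = Some S"
  obtains (cells_of) m where "shape d m" "\<And>i. m i \<le> l i" "D = cells_of m"
  | (move) i j where "1 \<le> i" "1 \<le> j" "(Suc i, Suc j) \<in> D" "(Suc i, j) \<notin> D" "(i, Suc j) \<notin> D"
proof -
  \<comment> \<open>Some cell of \<open>D\<close> can be moved back along its diagonal. Nothing is
    said about \<open>(i, j)\<close>: its membership in \<open>D\<close> only decides the type of
    the move.\<close>
  define bad where "bad \<longleftrightarrow> (\<exists>i\<ge>1. \<exists>j\<ge>1. (Suc i, Suc j) \<in> D \<and> (Suc i, j) \<notin> D \<and> (i, Suc j) \<notin> D)"
  define Q where "Q a b \<longleftrightarrow> (\<exists>S. demazure d D (reading_word l a b) = Some S) \<longrightarrow>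
    bad \<or> (\<exists>m. shape d m \<and> (\<forall>i. m i \<le> stage l a b i) \<and> D \<inter> set (reading_word l a b) = cells_of m)" for a b
  have "Q d (l d)"
    using d order_refl[of d] order_refl[of "l d"]
  proof (induction rule: reading_word_induct)
    case ground
    have "shape d (\<lambda>_. 0)" "D \<inter> set (reading_word l 1 0) = cells_of (\<lambda>_. 0)" by (auto simp: shape_def cells_of_def)
    then show ?case unfolding Q_def by fastforce
  next
    case (row a)
    then show ?case by (simp add: Q_def reading_word_row stage_row)
  next
    case (cell a b)
    show ?case unfolding Q_def
    proof (intro impI; rule ccontr)
      assume ex: "\<exists>S. demazure d D (reading_word l a (Suc b)) = Some S"
        and nc: "\<not> (bad \<or> (\<exists>m. shape d m \<and> (\<forall>i. m i \<le> stage l a (Suc b) i) \<and> D \<inter> set (reading_word l a (Suc b)) = cells_of m))"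
      obtain S where S: "demazure d D (reading_word l a (Suc b)) = Some S" using ex by blast
      then obtain V where V: "demazure d D (reading_word l a b) = Some V"
        unfolding reading_word_Suc by (rule demazure_prefix)
      have nb: "\<not> bad" using nc by blast
      obtain m where m: "shape d m" "\<And>i. m i \<le> stage l a b i" and Dm: "D \<inter> set (reading_word l a b) = cells_of m"
        using cell.IH V nb unfolding Q_def by blast
      have le: "m i \<le> stage l a (Suc b) i" for i
        using m(2)[of i] by (auto simp: stage_def split: if_splits)
      have xD: "(a, Suc b) \<in> D"
      proof (rule ccontr)
        assume "(a, Suc b) \<notin> D"
        then have "D \<inter> set (reading_word l a (Suc b)) = cells_of m" using Dm by (auto simp: reading_word_Suc)
        then show False using nc m(1) le by blast
      qed
      have "demazure d D (reading_word l a b) = Some (particles d m)"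
        using l cell.hyps m Dm by (intro demazure_cells_of) auto
      moreover define c where "c = d + Suc b - a"
      ultimately have hk: "hecke c (particles d m) = Some S"
        using S xD by (simp add: reading_word_Suc step_def)
      have mem: "(i, j) \<notin> D" if "1 \<le> i" "1 \<le> j" "j \<le> stage l a b i" "m i < j" for i j
      proof -
        have "(i, j) \<in> set (reading_word l a b)" using that cell.hyps by (simp add: set_reading_word)
        moreover have "(i, j) \<notin> cells_of m" using that by simp
        ultimately show ?thesis using Dm by blast
      qed
      \<comment> \<open>Under these bounds the new cell \<open>(a, Suc b)\<close> has both its left
        and its upper neighbour outside \<open>D\<close>.\<close>
      have badI: False if "2 \<le> a" "1 \<le> b" "m a < b" "m (a - 1) \<le> b"
      proof -
        have "(a, b) \<notin> D" using that by (intro mem) (auto simp: stage_def)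
        moreover have "l a \<le> l (a - 1)" using that by (intro shape_mono[OF l]) auto
        then have "(a - 1, Suc b) \<notin> D"
          using that cell.hyps by (intro mem) (auto simp: stage_def)
        ultimately have bad using that xD unfolding bad_def
          by (intro exI[of _ "a - 1"] conjI exI[of _ b]) auto
        then show False using nb by blast
      qed
      have zero: "m i = 0" if "i > a" for i using m(2)[of i] that by (simp add: stage_def)
      consider "c \<in> particles d m" "Suc c \<notin> particles d m" | "c \<notin> particles d m" "Suc c \<in> particles d m"
        using hk by (auto simp: hecke_def split: if_splits)
      then show False
      proof cases
        \<comment> \<open>The letter hops the particle of some row \<open>i\<close>. For
          \<open>i = a\<close> this adds a box to row \<open>a\<close>; for \<open>i < a\<close> the
          row lengths force a reverse move.\<close>
        case 1
        then obtain i where i: "1 \<le> i" "i \<le> d" "c = m i + d + 1 - i" by (auto simp: particles_def)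
        have eq: "m i + a = b + i" using i cell.hyps by (simp add: c_def)
        consider "i > a" | "i = a" | "i < a" by linarith
        then show False
        proof cases
          case 1
          then show False using eq zero by simp
        next
          case 2
          then have mb: "m a = b" using eq by simp
          have "a = 1 \<or> m a < m (a - 1)"
            using mem_particles_iff[OF m(1), of a] 1(2) 2 i by auto
          then have "shape d (m(a := Suc (m a)))" using m(1) cell.hyps by (intro shape_Suc) auto
          moreover have "(m(a := Suc (m a))) i \<le> stage l a (Suc b) i" for i
            using le[of i] mb by (auto simp: stage_def)
          moreover have "D \<inter> set (reading_word l a (Suc b)) = cells_of (m(a := Suc (m a)))"
          proof -
            have "D \<inter> set (reading_word l a (Suc b)) = insert (a, Suc b) (cells_of m)"
              using xD Dm by (auto simp: reading_word_Suc)
            also have "\<dots> = cells_of (m(a := Suc (m a)))"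
              using mb cell.hyps by (auto simp: cells_of_def split: if_splits)
            finally show ?thesis .
          qed
          ultimately show False using nc by blast
        next
          case 3
          have "m (a - 1) \<le> m i" "m a \<le> m i" using i 3 by (auto intro: shape_mono[OF m(1)])
          then show False using eq 3 i by (intro badI) linarith+
        qed
      next
        \<comment> \<open>The letter is absorbed by a particle already at \<open>Suc c\<close>. It
          must belong to a row \<open>i < a\<close>, and again there is a reverse move.\<close>
        case 2
        then obtain i where i: "1 \<le> i" "i \<le> d" "Suc c = m i + d + 1 - i" by (auto simp: particles_def)
        have eq: "m i + a = Suc b + i" using i cell.hyps by (simp add: c_def)
        consider "i > a" | "i = a" | "i < a" by linarith
        then show False
        proof cases
          case 1
          then show False using eq zero by simp
        next
          case 2
          then show False using eq m(2)[of a] by (simp add: stage_def)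
        next
          case 3
          have le: "m (a - 1) \<le> m i" "m a \<le> m (a - 1)" using i 3 by (auto intro: shape_mono[OF m(1)])
          \<comment> \<open>Length \<open>b\<close> would put the particle of row \<open>a\<close>
            at the empty site \<open>c\<close>.\<close>
          have "m a \<noteq> b"
          proof
            assume "m a = b"
            then have "c = m a + d + 1 - a" by (simp add: c_def)
            then show False using 2(1) cell.hyps by (auto simp: particles_def)
          qed
          moreover have "m i \<le> b" using eq 3 by linarith
          ultimately have "m a < b" "m (a - 1) \<le> b" using le by linarith+
          then show False using 3 i by (intro badI) auto
        qed
      qed
    qed
  qed
  moreover have "D \<inter> set (reading_word l d (l d)) = D" using D d by (auto simp: set_reading_word stage_full[OF l])
  ultimately have "bad \<or> (\<exists>m. shape d m \<and> (\<forall>i. m i \<le> l i) \<and> D = cells_of m)"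
    using dem by (auto simp: Q_def stage_full[OF l])
  then show thesis using that unfolding bad_def by blast
qed

text \<open>Moves preserve the Demazure product. Conversely, undoing moves lowers the sum of all
  coordinates until a straight shape remains, and its particle set identifies it as \<mu>.\<close>

lemma excited_eq_demazure:
  assumes lam: "diagram lam = cells_of l" "shape d l" "1 \<le> d"
    and mu: "diagram mu = cells_of m" "shape d m" "\<And>i. m i \<le> l i"
  shows "excited lam mu = {D. D \<subseteq> cells_of l \<and> demazure d D (reading_word l d (l d)) = Some (particles d m)}"
proof (intro set_eqI iffI; (elim CollectE conjE)?; (intro CollectI)?)
  fix D assume "D \<in> excited lam mu"
  then show "D \<subseteq> cells_of l \<and> demazure d D (reading_word l d (l d)) = Some (particles d m)"
  proof induction
    case base
    have "demazure d (cells_of m) (reading_word l d (l d)) = Some (particles d m)"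
      using lam mu by (intro demazure_cells_of) (auto simp: stage_full)
    moreover have "cells_of m \<subseteq> cells_of l" using mu(3) by (auto simp: cells_of_def intro: order_trans)
    ultimately show ?case by (simp add: mu)
  next
    case (move1 S i j)
    have "(i, j) \<in> cells_of l" using move1 by (auto simp: active_def)
    then have "1 \<le> i" "1 \<le> j" by simp_all
    with move1 show ?case
      using demazure_move(1)[of d l i j S] lam by (auto simp: active_def)
  next
    case (move2 S i j)
    have "(i, j) \<in> cells_of l" using move2 by (auto simp: active_def)
    then have "1 \<le> i" "1 \<le> j" by simp_all
    with move2 show ?case
      using demazure_move(2)[of d l i j S] lam by (auto simp: active_def)
  qed
next
  fix D assume "D \<subseteq> cells_of l" "demazure d D (reading_word l d (l d)) = Some (particles d m)"
  then show "D \<in> excited lam mu"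
  proof (induction "\<Sum>(i, j)\<in>D. i + j" arbitrary: D rule: less_induct)
    case (less D)
    from lam(2,3) less.prems show ?case
    proof (cases rule: cells_of_or_reverse_move)
      case (cells_of m')
      then have "demazure d D (reading_word l d (l d)) = Some (particles d m')"
        using lam by (intro demazure_cells_of) (auto simp: stage_full)
      then have "m' = m" using less.prems mu cells_of by (intro particles_inject) auto
      then show ?thesis using cells_of mu excited.base[of mu lam] by simp
    next
      case (move i j)
      \<comment> \<open>This set undoes either move: type II if \<open>(i, j)\<close> already lies
        in \<open>D\<close>, type I otherwise.\<close>
      define E where "E = D - {(Suc i, Suc j)} \<union> {(i, j)}"
      have fin: "finite D" using less.prems finite_cells_of[OF lam(2)] finite_subset by blast
      have l: "(Suc i, Suc j) \<in> cells_of l" by (rule subsetD[OF less.prems(1) move(3)])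
      moreover have "l (Suc i) \<le> l i" using move(1) by (intro shape_mono[OF lam(2)]) auto
      ultimately have l': "(i, j) \<in> cells_of l" "(Suc i, j) \<in> cells_of l" "(i, Suc j) \<in> cells_of l"
        using move(1,2) unfolding mem_cells_of by linarith+
      have active: "active lam E i j"
        unfolding active_def using move l l' lam by (auto simp: E_def)
      have D: "D = (if (i, j) \<in> D then E \<union> {(i + 1, j + 1)} else (E - {(i, j)}) \<union> {(i + 1, j + 1)})"
        using move by (auto simp: E_def)
      have "demazure d E (reading_word l d (l d)) = demazure d D (reading_word l d (l d))"
        using demazure_move[OF lam(2) move(1,2) l, of E] move D
        by (cases "(i, j) \<in> D") (auto simp: E_def)
      moreover have "(\<Sum>(i, j)\<in>E. i + j) < (\<Sum>(i, j)\<in>D. i + j)"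
      proof -
        have "(\<Sum>(i, j)\<in>D. i + j) = Suc i + Suc j + (\<Sum>(i, j)\<in>D - {(Suc i, Suc j)}. i + j)"
          using fin move by (subst sum.remove) auto
        moreover have "(\<Sum>(i, j)\<in>E. i + j) \<le> i + j + (\<Sum>(i, j)\<in>D - {(Suc i, Suc j)}. i + j)"
          using fin unfolding E_def by (auto simp: sum.insert_if)
        ultimately show ?thesis by simp
      qed
      moreover have "E \<subseteq> cells_of l" using less.prems l' by (auto simp: E_def)
      ultimately have "E \<in> excited lam mu" using less by auto
      then show ?thesis using D excited.move1[OF _ active] excited.move2[OF _ active]
        by (metis (no_types, lifting))
    qed
  qed
qed

section \<open>Transport of the eigenvector equation, cell by cell, from the empty shape to
  \<open>l\<close>\<close>

section \<open>The eigenvector equation along the reading word\<close>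

text \<open>\<open>z\<close> lists the row parameters \<open>X i\<close> and column parameters \<open>Y j\<close> in the order in which they occur
  along the boundary path of the intermediate shape \<open>stage l a b\<close>.\<close>

lemma eigen_reading_word:
  fixes X Y :: "nat \<Rightarrow> 'a::field"
  assumes l: "shape d l" and X: "\<And>i. 1 \<le> i \<Longrightarrow> i \<le> d \<Longrightarrow> X i \<noteq> 0"
    and conj: "\<And>i j. 1 \<le> i \<Longrightarrow> 1 \<le> j \<Longrightarrow> i \<le> l' j \<longleftrightarrow> j \<le> l i"
    and "1 \<le> a" "a \<le> d" "b \<le> l a"
    and "\<And>i. 1 \<le> i \<Longrightarrow> i \<le> d \<Longrightarrow> z (stage l a b i + d + 1 - i) = X i"
    and "\<And>j. 1 \<le> j \<Longrightarrow> j \<le> l 1 \<Longrightarrow> z (d + j - min (l' j) (if j \<le> b then a else a - 1)) = Y j"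
  shows "eigen (\<Prod>i=1..d. X i) z (subword_sum d (\<lambda>(i, j). Y j / X i - 1) (reading_word l a b))"
  using assms(4-)
proof (induction arbitrary: z rule: reading_word_induct)
  case ground
  \<comment> \<open>In the empty shape the sites from 1 to \<open>d\<close> carry the row parameters
    in reverse order.\<close>
  have "(\<Prod>i=1..d. X i) = (\<Prod>m=1..d. z m)"
  proof (rule prod.reindex_bij_witness[where i = "\<lambda>m. d + 1 - m" and j = "\<lambda>i. d + 1 - i"])
    fix i assume i: "i \<in> {1..d}"
    then show "z (d + 1 - i) = X i" using ground(1)[of i] by (simp add: stage_def)
  qed auto
  moreover have "subword_sum d (\<lambda>(i, j). Y j / X i - 1) (reading_word l 1 0) = (\<lambda>S. if S = {1..d} then 1 else 0)"
    by (rule ext) (simp only: reading_word_ground subword_sum_Nil)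
  ultimately show ?case by (simp only: eigen_ground)
next
  case (row a)
  have "eigen (\<Prod>i=1..d. X i) z (subword_sum d (\<lambda>(i, j). Y j / X i - 1) (reading_word l a (l a)))"
  proof (rule row.IH)
    fix i assume "1 \<le> i" "i \<le> d"
    then show "z (stage l a (l a) i + d + 1 - i) = X i" using row.prems(1)[of i] by (simp add: stage_row)
  next
    fix j assume j: "1 \<le> j" "j \<le> l 1"
    have "min (l' j) (if j \<le> l a then a else a - 1) = min (l' j) a"
      using conj[of a j] j row.hyps by auto
    then show "z (d + j - min (l' j) (if j \<le> l a then a else a - 1)) = Y j"
      using row.prems(2)[of j] j by simp
  qed
  then show ?case using row.hyps by (simp add: reading_word_row)
next
  case (cell a b)
  define c where "c = d + Suc b - a"
  \<comment> \<open>After the cell is added, row \<open>a\<close> labels the site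
    \<open>Suc c\<close> and column \<open>Suc b\<close> the site \<open>c\<close>; before, these
    labels are exchanged.\<close>
  define z' where "z' = z(c := z (Suc c), Suc c := z c)"
  have c1: "1 \<le> c" using cell.hyps by (simp add: c_def)
  have la: "l a \<le> l i" if "1 \<le> i" "i \<le> a" for i using that by (intro shape_mono[OF l])
  have XY: "z (Suc c) = X a" "z c = Y (Suc b)"
  proof -
    show "z (Suc c) = X a"
      using cell.prems(1)[of a] cell.hyps by (simp add: stage_def c_def Suc_diff_le add.commute)
    have "a \<le> l' (Suc b)" using conj[of a "Suc b"] cell.hyps by simp
    moreover have "Suc b \<le> l 1" using cell.hyps la[of 1] by simp
    ultimately show "z c = Y (Suc b)" using cell.prems(2)[of "Suc b"] by (simp add: c_def min_def split: if_splits)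
  qed
  have "eigen (\<Prod>i=1..d. X i) z' (subword_sum d (\<lambda>(i, j). Y j / X i - 1) (reading_word l a b))"
  proof (rule cell.IH)
    fix i assume i: "1 \<le> i" "i \<le> d"
    consider "i < a" | "i = a" | "i > a" by linarith
    then show "z' (stage l a b i + d + 1 - i) = X i"
    proof cases
      case 1
      then have "l i + d + 1 - i > Suc c" using la[of i] i cell.hyps by (simp add: c_def)
      then show ?thesis using cell.prems(1)[of i] i 1 by (simp add: stage_def z'_def)
    next
      case 2
      then show ?thesis using XY cell.hyps by (simp add: stage_def z'_def c_def Suc_diff_le add.commute)
    next
      case 3
      then have "d + 1 - i < c" using i cell.hyps by (simp add: c_def)
      then show ?thesis using cell.prems(1)[of i] i 3 by (simp add: stage_def z'_def)
    qed
  next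
    fix j assume j: "1 \<le> j" "j \<le> l 1"
    consider "j < Suc b" | "j = Suc b" | "j > Suc b" by linarith
    then show "z' (d + j - min (l' j) (if j \<le> b then a else a - 1)) = Y j"
    proof cases
      case 1
      then have "a \<le> l' j" using conj[of a j] j cell.hyps by simp
      moreover have "d + j - a < c" using 1 cell.hyps by (simp add: c_def)
      ultimately show ?thesis using cell.prems(2)[of j] 1 j by (simp add: z'_def min_def)
    next
      case 2
      then have "a \<le> l' j" using conj[of a j] j cell.hyps by simp
      then have "d + j - min (l' j) (if j \<le> b then a else a - 1) = Suc c"
        using 2 cell.hyps by (auto simp: c_def min_def)
      then show ?thesis using XY 2 by (simp add: z'_def)
    next
      case 3
      have "min (l' j) (a - 1) \<le> a - 1" by simp
      then have "d + j - min (l' j) (a - 1) > Suc c" using 3 cell.hyps unfolding c_def by linarith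
      then show ?thesis using cell.prems(2)[of j] 3 j by (simp add: z'_def)
    qed
  qed
  note IH = this
  have "(a, Suc b) \<notin> set (reading_word l a b)" using cell.hyps by (simp add: set_reading_word stage_def)
  note snoc = subword_sum_snoc[OF this, of c d]
  show ?case
    unfolding reading_word_Suc
  \<comment> \<open>With these labels the weight of the cell is exactly
    \<open>z c / z (Suc c) - 1\<close>, as the swap requires.\<close>
  proof (rule eigen_swap[OF IH c1, where p = "Y (Suc b) / X a - 1"])
    show "(Y (Suc b) / X a - 1) * z (Suc c) = z c - z (Suc c)"
      using X[of a] cell.hyps XY by (simp add: field_simps)
  qed (simp_all add: z'_def snoc c_def)
qed

section \<open>Increasing tableaux on sets of cells and the removal of the entries 1\<close>

section \<open>Recursion for increasing tableaux\<close>

text \<open>The conditions of \<open>SIT\<close> for any set of cells, since the recursion passes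
  from \<open>K\<close> to \<open>K - H\<close>.\<close>

definition tableaux :: "(nat \<times> nat) set \<Rightarrow> (nat \<times> nat \<Rightarrow> nat) set" where
  "tableaux K = {T.
     (\<forall>c. c \<notin> K \<longrightarrow> T c = 0) \<and> (\<forall>c \<in> K. T c \<ge> 1) \<and>
     (\<forall>i j. (i, j) \<in> K \<and> (i, j + 1) \<in> K \<longrightarrow> T (i, j) < T (i, j + 1)) \<and>
     (\<forall>i j. (i, j) \<in> K \<and> (i + 1, j) \<in> K \<longrightarrow> T (i, j) < T (i + 1, j)) \<and>
     (\<exists>m. T ` K = {1..m})}"

text \<open>The argument of \<open>\<phi>\<close> is the set of cells still unfilled before stage
  \<open>k\<close>, the complement in \<lambda> of the diagram formed by \<mu> and the entries below
  \<open>k\<close>.\<close>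

definition tab_sum :: "((nat \<times> nat) set \<Rightarrow> 'a::field) \<Rightarrow> (nat \<times> nat) set \<Rightarrow> 'a" where
  "tab_sum \<phi> K = (\<Sum>T\<in>tableaux K. \<Prod>k=1..card (T ` K). \<phi> {c \<in> K. k \<le> T c})"

text \<open>Neighbours are written with \<open>k + 1\<close> because truncated subtraction would
  make a cell with index 0 its own neighbour.\<close>

definition minimal_cells :: "(nat \<times> nat) set \<Rightarrow> (nat \<times> nat) set" where
  "minimal_cells K = {(i, j). (i, j) \<in> K \<and> (\<forall>k. i = k + 1 \<longrightarrow> (k, j) \<notin> K) \<and> (\<forall>k. j = k + 1 \<longrightarrow> (i, k) \<notin> K)}"

lemma finite_tableaux:
  assumes "finite K"
  shows "finite (tableaux K)"
proof (rule finite_subset)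
  show "tableaux K \<subseteq> {T. \<forall>c. (c \<in> K \<longrightarrow> T c \<in> {..card K}) \<and> (c \<notin> K \<longrightarrow> T c = 0)}"
  proof (rule subsetI, rule CollectI, intro allI conjI impI)
    fix T c assume T: "T \<in> tableaux K" and c: "c \<in> K"
    obtain m where m: "T ` K = {1..m}" using T by (auto simp: tableaux_def)
    have "m \<le> card K" using card_image_le[OF assms, of T] m by simp
    moreover have "T c \<in> {1..m}" using c m by blast
    ultimately show "T c \<in> {..card K}" by simp
  qed (auto simp: tableaux_def)
  show "finite {T. \<forall>c. (c \<in> K \<longrightarrow> T c \<in> {..card K}) \<and> (c \<notin> K \<longrightarrow> T c = (0::nat))}"
    by (rule finite_set_of_finite_funs) (use assms in auto)
qed

lemma tab_sum_empty [simp]: "tab_sum \<phi> {} = 1"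
proof -
  have "tableaux {} = {\<lambda>_. 0}" by (auto simp: tableaux_def intro!: exI[of _ 0])
  then show ?thesis by (simp add: tab_sum_def)
qed

text \<open>The cells with entry 1 form a nonempty set \<open>H\<close> of minimal cells. Deleting
  them and lowering all other entries by 1 is a bijection onto pairs of such an \<open>H\<close> and
  a tableau on \<open>K - H\<close>; the factor for \<open>k = 1\<close> is
  \<open>\<phi> K\<close>.\<close>

lemma tab_sum_rec:
  assumes fin: "finite K" and ne: "K \<noteq> {}"
  shows "tab_sum \<phi> K = \<phi> K * (\<Sum>H\<in>Pow (minimal_cells K) - {{}}. tab_sum \<phi> (K - H))"
proof -
  define \<H> where "\<H> = Pow (minimal_cells K) - {{}}"
  define ones where "ones T = {c \<in> K. T c = (1::nat)}" for T
  define dec :: "(nat \<times> nat \<Rightarrow> nat) \<Rightarrow> nat \<times> nat \<Rightarrow> nat" where "dec T = (\<lambda>c. T c - 1)" for T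
  \<comment> \<open>A tableau on \<open>K - H\<close> is 0 on \<open>H\<close>, so raising all of
    \<open>K\<close> by 1 gives the cells of \<open>H\<close> the entry 1.\<close>
  define inc where "inc T = (\<lambda>c. if c \<in> K then Suc (T c) else 0)" for T
  have sub: "minimal_cells K \<subseteq> K" by (auto simp: minimal_cells_def)
  have fin\<H>: "finite \<H>" using finite_subset[OF sub fin] by (simp add: \<H>_def)
  have fwd: "ones T \<in> \<H>" "dec T \<in> tableaux (K - ones T)" "inc (dec T) = T"
    "(\<Prod>k=1..card (T ` K). \<phi> {c \<in> K. k \<le> T c}) =
     \<phi> K * (\<Prod>k=1..card (dec T ` (K - ones T)). \<phi> {c \<in> K - ones T. k \<le> dec T c})"
    if T: "T \<in> tableaux K" for T
  proof -
    have pos: "c \<in> K \<Longrightarrow> 1 \<le> T c" and zero: "c \<notin> K \<Longrightarrow> T c = 0"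
      and row: "(i, j) \<in> K \<Longrightarrow> (i, j + 1) \<in> K \<Longrightarrow> T (i, j) < T (i, j + 1)"
      and col: "(i, j) \<in> K \<Longrightarrow> (i + 1, j) \<in> K \<Longrightarrow> T (i, j) < T (i + 1, j)" for c i j
    proof -
      note T' = T[unfolded tableaux_def mem_Collect_eq]
      show "c \<in> K \<Longrightarrow> 1 \<le> T c" using T'[THEN conjunct2, THEN conjunct1] by blast
      show "c \<notin> K \<Longrightarrow> T c = 0" using T'[THEN conjunct1] by blast
      show "(i, j) \<in> K \<Longrightarrow> (i, j + 1) \<in> K \<Longrightarrow> T (i, j) < T (i, j + 1)"
        using T'[THEN conjunct2, THEN conjunct2, THEN conjunct1] by blast
      show "(i, j) \<in> K \<Longrightarrow> (i + 1, j) \<in> K \<Longrightarrow> T (i, j) < T (i + 1, j)"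
        using T'[THEN conjunct2, THEN conjunct2, THEN conjunct2, THEN conjunct1] by blast
    qed
    obtain m where m: "T ` K = {1..m}" using T by (auto simp: tableaux_def)
    obtain n where n: "m = Suc n" using m ne by (cases m) auto
    have "1 \<in> T ` K" using m n by simp
    then obtain c where "c \<in> K" "T c = 1" by (metis imageE)
    then have "ones T \<noteq> {}" unfolding ones_def by blast
    moreover have "ones T \<subseteq> minimal_cells K"
    proof (clarsimp simp: ones_def minimal_cells_def, intro conjI allI impI notI)
      fix i j k assume a: "(i, j) \<in> K" "T (i, j) = Suc 0"
      { assume "i = Suc k" "(k, j) \<in> K" then show False using a pos[of "(k, j)"] col[of k j] by simp }
      { assume "j = Suc k" "(i, k) \<in> K" then show False using a pos[of "(i, k)"] row[of i k] by simp }
    qed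
    ultimately show "ones T \<in> \<H>" by (simp add: \<H>_def)
    have img: "dec T ` (K - ones T) = {1..n}"
    proof -
      have "dec T ` (K - ones T) = (\<lambda>k. k - 1) ` (T ` K - {1})"
        by (auto simp: dec_def ones_def image_image)
      also have "\<dots> = {1..n}"
        unfolding m n by (auto simp: image_iff intro!: bexI[of _ "Suc _"])
      finally show ?thesis .
    qed
    show "dec T \<in> tableaux (K - ones T)"
      unfolding tableaux_def
    proof (intro CollectI conjI allI impI ballI)
      fix c assume "c \<notin> K - ones T"
      then show "dec T c = 0" using zero[of c] by (auto simp: dec_def ones_def)
    next
      fix c assume "c \<in> K - ones T"
      then show "1 \<le> dec T c" using pos[of c] by (auto simp: dec_def ones_def)
    next
      fix i j assume "(i, j) \<in> K - ones T \<and> (i, j + 1) \<in> K - ones T"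
      then show "dec T (i, j) < dec T (i, j + 1)"
        using pos[of "(i, j)"] row[of i j] by (auto simp: dec_def)
    next
      fix i j assume "(i, j) \<in> K - ones T \<and> (i + 1, j) \<in> K - ones T"
      then show "dec T (i, j) < dec T (i + 1, j)"
        using pos[of "(i, j)"] col[of i j] by (auto simp: dec_def)
    qed (use img in blast)
    show "inc (dec T) = T"
    proof (rule ext)
      fix c show "inc (dec T) c = T c"
        using pos[of c] zero[of c] by (auto simp: inc_def dec_def)
    qed
    have "{c \<in> K. 1 \<le> T c} = K" using pos by blast
    moreover have "{c \<in> K. Suc k \<le> T c} = {c \<in> K - ones T. k \<le> dec T c}" if "1 \<le> k" for k
      using that by (auto simp: ones_def dec_def)
    moreover have "(\<Prod>k=1..Suc n. \<phi> {c \<in> K. k \<le> T c}) =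
        \<phi> {c \<in> K. 1 \<le> T c} * (\<Prod>k=1..n. \<phi> {c \<in> K. Suc k \<le> T c})"
      by (subst prod.atLeast_Suc_atMost) (simp_all only: prod.atLeast_Suc_atMost_Suc_shift o_def One_nat_def le_add1 plus_1_eq_Suc)
    ultimately show "(\<Prod>k=1..card (T ` K). \<phi> {c \<in> K. k \<le> T c}) =
     \<phi> K * (\<Prod>k=1..card (dec T ` (K - ones T)). \<phi> {c \<in> K - ones T. k \<le> dec T c})"
      unfolding m img n by simp
  qed
  have bwd: "inc T \<in> tableaux K" "ones (inc T) = H" "dec (inc T) = T"
    if H: "H \<in> \<H>" and T: "T \<in> tableaux (K - H)" for H T
  proof -
    have pos: "c \<in> K \<Longrightarrow> c \<notin> H \<Longrightarrow> 1 \<le> T c" and zero: "c \<notin> K \<or> c \<in> H \<Longrightarrow> T c = 0"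
      and row: "(i, j) \<in> K - H \<Longrightarrow> (i, j + 1) \<in> K - H \<Longrightarrow> T (i, j) < T (i, j + 1)"
      and col: "(i, j) \<in> K - H \<Longrightarrow> (i + 1, j) \<in> K - H \<Longrightarrow> T (i, j) < T (i + 1, j)" for c i j
    proof -
      note T' = T[unfolded tableaux_def mem_Collect_eq]
      show "c \<in> K \<Longrightarrow> c \<notin> H \<Longrightarrow> 1 \<le> T c" using T'[THEN conjunct2, THEN conjunct1] by blast
      show "c \<notin> K \<or> c \<in> H \<Longrightarrow> T c = 0" using T'[THEN conjunct1] by blast
      show "(i, j) \<in> K - H \<Longrightarrow> (i, j + 1) \<in> K - H \<Longrightarrow> T (i, j) < T (i, j + 1)"
        using T'[THEN conjunct2, THEN conjunct2, THEN conjunct1] by blast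
      show "(i, j) \<in> K - H \<Longrightarrow> (i + 1, j) \<in> K - H \<Longrightarrow> T (i, j) < T (i + 1, j)"
        using T'[THEN conjunct2, THEN conjunct2, THEN conjunct2, THEN conjunct1] by blast
    qed
    obtain m where m: "T ` (K - H) = {1..m}" using T by (auto simp: tableaux_def)
    have HK: "H \<subseteq> K" "H \<noteq> {}" and Hmin: "H \<subseteq> minimal_cells K" using H sub by (auto simp: \<H>_def)
    have "inc T ` K = Suc ` (T ` H \<union> T ` (K - H))"
      using HK by (auto simp: inc_def)
    also have "T ` H = {0}" using HK zero by auto
    also have "Suc ` ({0} \<union> T ` (K - H)) = {1..Suc m}"
      unfolding m image_Un image_Suc_atLeastAtMost by auto
    finally have img: "inc T ` K = {1..Suc m}" .
    show "inc T \<in> tableaux K"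
      unfolding tableaux_def
    proof (intro CollectI conjI allI impI ballI)
      fix i j assume a: "(i, j) \<in> K \<and> (i, j + 1) \<in> K"
      then have nH: "(i, j + 1) \<notin> H" using Hmin by (auto simp: minimal_cells_def)
      then show "inc T (i, j) < inc T (i, j + 1)"
        using a row[of i j] pos[of "(i, j + 1)"] zero[of "(i, j)"]
        by (cases "(i, j) \<in> H") (auto simp: inc_def)
    next
      fix i j assume a: "(i, j) \<in> K \<and> (i + 1, j) \<in> K"
      then have nH: "(i + 1, j) \<notin> H" using Hmin by (auto simp: minimal_cells_def)
      then show "inc T (i, j) < inc T (i + 1, j)"
        using a col[of i j] pos[of "(i + 1, j)"] zero[of "(i, j)"]
        by (cases "(i, j) \<in> H") (auto simp: inc_def)
    qed (use img in \<open>auto simp: inc_def\<close>)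
    show "ones (inc T) = H"
    proof (rule set_eqI)
      fix c show "c \<in> ones (inc T) \<longleftrightarrow> c \<in> H"
        using HK(1) zero[of c] pos[of c] by (cases "c \<in> H") (auto simp: ones_def inc_def)
    qed
    show "dec (inc T) = T"
    proof (rule ext)
      fix c show "dec (inc T) c = T c" using zero[of c] by (auto simp: dec_def inc_def)
    qed
  qed
  have "tab_sum \<phi> K = (\<Sum>(H, T)\<in>Sigma \<H> (\<lambda>H. tableaux (K - H)).
      \<phi> K * (\<Prod>k=1..card (T ` (K - H)). \<phi> {c \<in> K - H. k \<le> T c}))"
    unfolding tab_sum_def
  proof (rule sum.reindex_bij_witness[where i = "\<lambda>(H, T). inc T" and j = "\<lambda>T. (ones T, dec T)"])
    fix T assume T: "T \<in> tableaux K"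
    show "(case (ones T, dec T) of (H, T) \<Rightarrow> inc T) = T" using fwd(3)[OF T] by simp
    show "(ones T, dec T) \<in> Sigma \<H> (\<lambda>H. tableaux (K - H))" using fwd(1,2)[OF T] by simp
    show "(case (ones T, dec T) of (H, T) \<Rightarrow>
        \<phi> K * (\<Prod>k=1..card (T ` (K - H)). \<phi> {c \<in> K - H. k \<le> T c})) =
        (\<Prod>k=1..card (T ` K). \<phi> {c \<in> K. k \<le> T c})"
      unfolding fwd(4)[OF T] prod.case ..
  next
    fix HT assume "HT \<in> Sigma \<H> (\<lambda>H. tableaux (K - H))"
    then obtain H T where HT: "HT = (H, T)" "H \<in> \<H>" "T \<in> tableaux (K - H)" by blast
    show "(\<lambda>T. (ones T, dec T)) (case HT of (H, T) \<Rightarrow> inc T) = HT"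
      using bwd(2,3)[OF HT(2,3)] by (simp add: HT(1))
    show "(case HT of (H, T) \<Rightarrow> inc T) \<in> tableaux K"
      using bwd(1)[OF HT(2,3)] by (simp add: HT(1))
  qed
  also have "\<dots> = (\<Sum>H\<in>\<H>. \<Sum>T\<in>tableaux (K - H).
      \<phi> K * (\<Prod>k=1..card (T ` (K - H)). \<phi> {c \<in> K - H. k \<le> T c}))"
    by (rule sum.Sigma[symmetric]) (use fin fin\<H> finite_tableaux in auto)
  finally show ?thesis by (simp add: tab_sum_def sum_distrib_left \<H>_def)
qed

section \<open>Sets of corners as hop sets, and the comparison of the two recursions\<close>

section \<open>Corners as particle hops\<close>

definition addable :: "nat \<Rightarrow> (nat \<Rightarrow> nat) \<Rightarrow> nat set" where
  "addable d m = {i \<in> {1..d}. i = 1 \<or> m i < m (i - 1)}"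

definition add_boxes :: "(nat \<Rightarrow> nat) \<Rightarrow> nat set \<Rightarrow> nat \<Rightarrow> nat" where
  "add_boxes m I i = (if i \<in> I then Suc (m i) else m i)"

text \<open>An addable row below the first is strictly shorter than the one above it, so any set of
  addable rows can grow simultaneously.\<close>

lemma shape_add_boxes:
  assumes m: "shape d m" and I: "I \<subseteq> addable d m"
  shows "shape d (add_boxes m I)"
  unfolding shape_def
proof (intro conjI allI impI)
  fix i :: nat assume "1 \<le> i"
  then have "m (Suc i) \<le> m i" using m by (auto simp: shape_def)
  moreover have "m (Suc i) < m i" if "Suc i \<in> I" using I that \<open>1 \<le> i\<close> by (auto simp: addable_def)
  ultimately show "add_boxes m I (Suc i) \<le> add_boxes m I i" by (auto simp: add_boxes_def)
qed (use m I in \<open>auto simp: add_boxes_def shape_def addable_def\<close>)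

lemma hoppable_particles:
  assumes "shape d m"
  shows "hoppable (particles d m) = (\<lambda>i. m i + d + 1 - i) ` addable d m"
proof (rule set_eqI)
  fix s
  have "s \<in> hoppable (particles d m) \<longleftrightarrow>
      (\<exists>i\<in>{1..d}. s = m i + d + 1 - i \<and> Suc (m i + d + 1 - i) \<notin> particles d m)"
    unfolding hoppable_def by (auto simp: particles_def)
  also have "\<dots> \<longleftrightarrow> (\<exists>i\<in>{1..d}. s = m i + d + 1 - i \<and> (i = 1 \<or> m i < m (i - 1)))"
    using mem_particles_iff[OF assms] by (intro bex_cong) auto
  finally show "s \<in> hoppable (particles d m) \<longleftrightarrow> s \<in> (\<lambda>i. m i + d + 1 - i) ` addable d m"
    by (auto simp: addable_def)
qed

lemma hop_particles:
  assumes m: "shape d m" and I: "I \<subseteq> addable d m"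
  shows "hop (particles d m) ((\<lambda>i. m i + d + 1 - i) ` I) = particles d (add_boxes m I)"
proof -
  have I': "I \<subseteq> {1..d}" using I by (auto simp: addable_def)
  have "particles d m - (\<lambda>i. m i + d + 1 - i) ` I = (\<lambda>i. m i + d + 1 - i) ` ({1..d} - I)"
    unfolding particles_def by (rule inj_on_image_set_diff[OF inj_particles[OF m], symmetric]) (use I' in auto)
  also have "\<dots> = (\<lambda>i. add_boxes m I i + d + 1 - i) ` ({1..d} - I)"
    by (rule image_cong) (auto simp: add_boxes_def)
  finally have 1: "particles d m - (\<lambda>i. m i + d + 1 - i) ` I = (\<lambda>i. add_boxes m I i + d + 1 - i) ` ({1..d} - I)" .
  have 2: "Suc ` (\<lambda>i. m i + d + 1 - i) ` I = (\<lambda>i. add_boxes m I i + d + 1 - i) ` I"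
    unfolding image_image by (rule image_cong) (use I' in \<open>auto simp: add_boxes_def Suc_diff_le\<close>)
  have "({1..d} - I) \<union> I = {1..d}" using I' by blast
  then show ?thesis
    unfolding hop_def 1 2 image_Un[symmetric] by (simp only: particles_def)
qed

text \<open>Turns the sum over hop sets in \<open>eigen\<close> into a sum over sets of corners,
  through the bijection between rows and particles.\<close>

lemma sum_hops:
  assumes m: "shape d m"
  shows "(\<Sum>H\<in>Pow (hoppable (particles d m)). f (hop (particles d m) H)) =
    (\<Sum>I\<in>Pow (addable d m). f (particles d (add_boxes m I)))"
proof -
  have "inj_on (\<lambda>i. m i + d + 1 - i) (addable d m)"
    by (rule inj_on_subset[OF inj_particles[OF m]]) (auto simp: addable_def)
  then have inj: "inj_on (image (\<lambda>i. m i + d + 1 - i)) (Pow (addable d m))"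
    by (rule inj_on_image_Pow)
  have "Pow (hoppable (particles d m)) = image (\<lambda>i. m i + d + 1 - i) ` Pow (addable d m)"
    unfolding hoppable_particles[OF m] by (rule image_Pow_surj[OF refl, symmetric])
  then have "(\<Sum>H\<in>Pow (hoppable (particles d m)). f (hop (particles d m) H)) =
      (\<Sum>I\<in>Pow (addable d m). f (hop (particles d m) ((\<lambda>i. m i + d + 1 - i) ` I)))"
    by (simp only: sum.reindex[OF inj] o_def)
  also have "\<dots> = (\<Sum>I\<in>Pow (addable d m). f (particles d (add_boxes m I)))"
    by (rule sum.cong[OF refl]) (simp only: hop_particles[OF m] Pow_iff)
  finally show ?thesis .
qed

text \<open>By dominance no subword reaches a shape that leaves \<open>l\<close>. This cuts the
  eigenvector sum down to the corners inside \<open>l\<close>.\<close>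

lemma subword_sum_vanishes:
  assumes l: "shape d l" "1 \<le> d" and m: "shape d m" and i: "\<not> m i \<le> l i"
  shows "subword_sum d p (reading_word l d (l d)) (particles d m) = 0"
proof -
  have "{D. D \<subseteq> set (reading_word l d (l d)) \<and> demazure d D (reading_word l d (l d)) = Some (particles d m)} = {}"
    using demazure_dominated[OF l(1), of d "l d" _ "particles d m"] l dominated_imp_le[OF m l(1)] i
    by (auto simp: stage_full)
  then show ?thesis by (simp only: subword_sum_def sum.empty)
qed

definition growable :: "nat \<Rightarrow> (nat \<Rightarrow> nat) \<Rightarrow> (nat \<Rightarrow> nat) \<Rightarrow> nat set" where
  "growable d l m = {i \<in> addable d m. m i < l i}"

text \<open>With \<open>cells_of_add_boxes\<close>, this identifies removing minimal cells of the
  skew shape with adding corners to \<open>m\<close>.\<close>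

lemma minimal_cells_skew:
  assumes l: "shape d l" and m: "shape d m"
  shows "minimal_cells (cells_of l - cells_of m) = (\<lambda>i. (i, Suc (m i))) ` growable d l m"
proof (rule set_eqI, clarify)
  fix i j
  show "(i, j) \<in> minimal_cells (cells_of l - cells_of m) \<longleftrightarrow> (i, j) \<in> (\<lambda>i. (i, Suc (m i))) ` growable d l m"
  proof
    assume "(i, j) \<in> minimal_cells (cells_of l - cells_of m)"
    then have c: "1 \<le> i" "1 \<le> j" "j \<le> l i" "m i < j"
      and up: "\<And>k. i = Suc k \<Longrightarrow> 1 \<le> k \<Longrightarrow> j \<le> l k \<Longrightarrow> j \<le> m k"
      and left: "\<And>k. j = Suc k \<Longrightarrow> 1 \<le> k \<Longrightarrow> k \<le> m i"
      by (auto simp: minimal_cells_def)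
    have "i \<le> d" using c l by (auto simp: shape_def intro: ccontr)
    have j: "j = Suc (m i)"
    proof (cases "j = 1")
      case False
      then have "j - 1 \<le> m i" using c by (intro left) linarith+
      then show ?thesis using c by linarith
    qed (use c in simp)
    have "i = 1 \<or> m i < m (i - 1)"
    proof (cases "i = 1")
      case False
      then have "l i \<le> l (i - 1)" using c by (intro shape_mono[OF l]) auto
      moreover have "j \<le> l (i - 1) \<Longrightarrow> j \<le> m (i - 1)" using False c by (intro up) linarith+
      ultimately show ?thesis using c by linarith
    qed simp
    then show "(i, j) \<in> (\<lambda>i. (i, Suc (m i))) ` growable d l m"
      using c j \<open>i \<le> d\<close> by (auto simp: growable_def addable_def)
  next
    assume "(i, j) \<in> (\<lambda>i. (i, Suc (m i))) ` growable d l m"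
    then have "1 \<le> i" "i = 1 \<or> m i < m (i - 1)" "j = Suc (m i)" "m i < l i"
      by (auto simp: growable_def addable_def)
    then show "(i, j) \<in> minimal_cells (cells_of l - cells_of m)"
      by (auto simp: minimal_cells_def)
  qed
qed

lemma cells_of_add_boxes:
  assumes "I \<subseteq> growable d l m"
  shows "cells_of l - cells_of m - (\<lambda>i. (i, Suc (m i))) ` I = cells_of l - cells_of (add_boxes m I)"
  using assms by (auto simp: add_boxes_def cells_of_def image_iff split: if_splits)

lemma card_row:
  assumes "1 \<le> i"
  shows "card {j. (i, j) \<in> cells_of m} = m i"
proof -
  have "{j. (i, j) \<in> cells_of m} = {1..m i}" using assms by auto
  then show ?thesis by simp
qed

text \<open>Splitting off the empty set of corners in the eigenvector equation gives
  \<open>(w - 1) * f m\<close> as the sum of \<open>f\<close> over all shapes with at least one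
  corner added, where \<open>w\<close> is the product of the ratios \<open>z / X\<close>. This is
  \<open>tab_sum_rec\<close> with \<open>\<phi>\<close> equal to \<open>1 / (w - 1)\<close>;
  division by \<open>P\<close> normalizes the value at \<open>m = l\<close> to 1.\<close>

lemma tab_sum_eq_subword_sum:
  fixes X Y z :: "nat \<Rightarrow> 'a::field"
  assumes l: "shape d l" "1 \<le> d" and m: "shape d m" "\<And>i. m i \<le> l i"
    and X: "\<And>i. 1 \<le> i \<Longrightarrow> i \<le> d \<Longrightarrow> X i \<noteq> 0"
    and eig: "eigen (\<Prod>i=1..d. X i) z (subword_sum d p (reading_word l d (l d)))"
    and top: "subword_sum d p (reading_word l d (l d)) (particles d l) = P" "P \<noteq> 0"
    and ne: "\<And>m. shape d m \<Longrightarrow> (\<And>i. m i \<le> l i) \<Longrightarrow> m \<noteq> l \<Longrightarrow> (\<Prod>i=1..d. z (m i + d + 1 - i) / X i) \<noteq> 1"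
    and \<phi>: "\<And>K. \<phi> K = inverse ((\<Prod>i=1..d. z (card {j. (i, j) \<in> cells_of l - K} + d + 1 - i) / X i) - 1)"
  shows "tab_sum \<phi> (cells_of l - cells_of m) = subword_sum d p (reading_word l d (l d)) (particles d m) / P"
  using m
proof (induction "card (cells_of l - cells_of m)" arbitrary: m rule: less_induct)
  case less
  define f where "f m = subword_sum d p (reading_word l d (l d)) (particles d m)" for m
  define K where "K = cells_of l - cells_of m"
  have sub: "cells_of m \<subseteq> cells_of l" using less.prems by (auto simp: cells_of_def intro: order_trans)
  have finK: "finite K" unfolding K_def using finite_cells_of[OF l(1)] by simp
  show ?case
  proof (cases "m = l")
    case True
    then show ?thesis using top by simp
  next
    case False
    then obtain i where i: "m i < l i" using less.prems by (metis ext le_neq_implies_less)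
    then have "(i, l i) \<in> K" using l by (cases "i = 0") (auto simp: K_def shape_def)
    then have "K \<noteq> {}" by blast
    define w where "w = (\<Prod>i=1..d. z (m i + d + 1 - i) / X i)"
    have w1: "w \<noteq> 1" unfolding w_def using less.prems False by (intro ne) auto
    have "cells_of l - K = cells_of m" using sub by (auto simp: K_def)
    then have \<phi>K: "\<phi> K = inverse (w - 1)" unfolding \<phi> w_def using card_row[of _ m] by simp
    define E where "E = (\<Prod>i=1..d. X i)"
    have "E \<noteq> 0" using X by (simp add: E_def)
    have "(\<Prod>s\<in>particles d m. z s) = (\<Prod>i=1..d. z (m i + d + 1 - i))"
      unfolding particles_def using inj_particles[OF less.prems(1)] by (subst prod.reindex) auto
    also have "\<dots> = E * w" using \<open>E \<noteq> 0\<close> by (simp add: w_def E_def prod_dividef)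
    finally have zE: "(\<Prod>s\<in>particles d m. z s) = E * w" .
    have fa: "finite (addable d m)" by (simp add: addable_def)
    have "E * w * f m = (\<Prod>s\<in>particles d m. z s) * subword_sum d p (reading_word l d (l d)) (particles d m)"
      by (simp only: zE f_def)
    also have "\<dots> = E * (\<Sum>H\<in>Pow (hoppable (particles d m)). subword_sum d p (reading_word l d (l d)) (hop (particles d m) H))"
      unfolding E_def
      by (rule eig[unfolded eigen_def, rule_format]) (simp add: zero_notin_particles)
    also have "(\<Sum>H\<in>Pow (hoppable (particles d m)). subword_sum d p (reading_word l d (l d)) (hop (particles d m) H)) =
        (\<Sum>I\<in>Pow (addable d m). f (add_boxes m I))"
      unfolding f_def by (rule sum_hops[OF less.prems(1)])
    also have "\<dots> = f m + (\<Sum>I\<in>Pow (addable d m) - {{}}. f (add_boxes m I))"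
      using fa by (subst sum.remove[of _ "{}"]) (auto simp: add_boxes_def[abs_def])
    also have "(\<Sum>I\<in>Pow (addable d m) - {{}}. f (add_boxes m I)) =
        (\<Sum>I\<in>Pow (growable d l m) - {{}}. f (add_boxes m I))"
    proof (rule sum.mono_neutral_right)
      show "\<forall>I\<in>Pow (addable d m) - {{}} - (Pow (growable d l m) - {{}}). f (add_boxes m I) = 0"
      proof
        fix I assume I: "I \<in> Pow (addable d m) - {{}} - (Pow (growable d l m) - {{}})"
        then obtain i where "i \<in> I" "\<not> m i < l i" by (auto simp: growable_def)
        then have "\<not> add_boxes m I i \<le> l i" by (auto simp: add_boxes_def)
        then show "f (add_boxes m I) = 0"
          unfolding f_def using I by (intro subword_sum_vanishes[OF l] shape_add_boxes[OF less.prems(1)]) auto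
      qed
    qed (use fa in \<open>auto simp: growable_def\<close>)
    finally have "w * f m = f m + (\<Sum>I\<in>Pow (growable d l m) - {{}}. f (add_boxes m I))"
      using \<open>E \<noteq> 0\<close> by simp
    then have rec: "(\<Sum>I\<in>Pow (growable d l m) - {{}}. f (add_boxes m I)) = (w - 1) * f m"
      by (simp add: algebra_simps)
    have inj: "inj_on (image (\<lambda>i. (i, Suc (m i)))) (Pow (growable d l m))"
      by (rule inj_on_image_Pow) (auto simp: inj_on_def)
    have "Pow (minimal_cells K) - {{}} = image (\<lambda>i. (i, Suc (m i))) ` (Pow (growable d l m) - {{}})"
      unfolding K_def minimal_cells_skew[OF l(1) less.prems(1)] image_Pow_surj[OF refl, symmetric] by auto
    then have "(\<Sum>H\<in>Pow (minimal_cells K) - {{}}. tab_sum \<phi> (K - H)) =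
        (\<Sum>I\<in>Pow (growable d l m) - {{}}. tab_sum \<phi> (K - (\<lambda>i. (i, Suc (m i))) ` I))"
      using inj_on_subset[OF inj, of "Pow (growable d l m) - {{}}"] by (simp add: sum.reindex)
    also have "\<dots> = (\<Sum>I\<in>Pow (growable d l m) - {{}}. f (add_boxes m I) / P)"
    proof (rule sum.cong[OF refl])
      fix I assume I: "I \<in> Pow (growable d l m) - {{}}"
      then have I': "I \<subseteq> growable d l m" "I \<subseteq> addable d m" by (auto simp: growable_def)
      have eq: "K - (\<lambda>i. (i, Suc (m i))) ` I = cells_of l - cells_of (add_boxes m I)"
        unfolding K_def by (rule cells_of_add_boxes[OF I'(1)])
      have "(\<lambda>i. (i, Suc (m i))) ` I \<subseteq> K"
        using I'(1) by (auto simp: K_def growable_def addable_def)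
      then have "cells_of l - cells_of (add_boxes m I) \<subset> K" using eq I by blast
      then have "card (cells_of l - cells_of (add_boxes m I)) < card (cells_of l - cells_of m)"
        using psubset_card_mono[OF finK] by (simp add: K_def)
      moreover have "shape d (add_boxes m I)" by (rule shape_add_boxes[OF less.prems(1) I'(2)])
      moreover have "add_boxes m I i \<le> l i" for i
        using I'(1) less.prems(2)[of i] by (auto simp: add_boxes_def growable_def)
      ultimately show "tab_sum \<phi> (K - (\<lambda>i. (i, Suc (m i))) ` I) = f (add_boxes m I) / P"
        unfolding eq f_def by (rule less.hyps)
    qed
    also have "\<dots> = (w - 1) * f m / P" unfolding rec[symmetric] by (simp add: sum_divide_distrib)
    finally have "tab_sum \<phi> K = inverse (w - 1) * ((w - 1) * f m / P)"
      using tab_sum_rec[OF finK \<open>K \<noteq> {}\<close>, of \<phi>] \<phi>K by simp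
    then show ?thesis using w1 by (simp add: f_def K_def)
  qed
qed

section \<open>Conjugate partitions, boundary cases, and the identity for arbitrary
  parameters\<close>

section \<open>The identity over a field\<close>

text \<open>The rows meeting column \<open>j\<close> form a finite down-closed set of positive
  integers, hence an initial interval.\<close>

lemma conj_part_iff:
  assumes "shape d (part lam)" "1 \<le> i" "1 \<le> j"
  shows "i \<le> conj_part lam j \<longleftrightarrow> j \<le> part lam i"
proof -
  define A where "A = {i. (i, j) \<in> diagram lam}"
  have A: "A = {i. 1 \<le> i \<and> j \<le> part lam i}" using assms by (auto simp: A_def diagram_def)
  have "A \<subseteq> {1..d}"
    using assms unfolding A shape_def by (auto simp: not_less[symmetric] intro: ccontr)
  then have fin: "finite A" by (rule finite_subset) simp
  have down: "k \<in> A" if "i' \<in> A" "1 \<le> k" "k \<le> i'" for k i'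
    using that shape_mono[OF assms(1), of k i'] by (auto simp: A)
  have card: "conj_part lam j = card A" by (simp add: conj_part_def A_def)
  have "A = {1..card A}"
  proof (cases "A = {}")
    case False
    have "A = {1..Max A}"
    proof (rule set_eqI)
      fix k
      have "k \<in> A \<Longrightarrow> 1 \<le> k" by (simp add: A)
      then show "k \<in> A \<longleftrightarrow> k \<in> {1..Max A}"
        using Max_ge[OF fin] down[OF Max_in[OF fin False]] by (metis atLeastAtMost_iff)
    qed
    then show ?thesis by (metis card_atLeastAtMost diff_Suc_1)
  qed simp
  then have "i \<in> A \<longleftrightarrow> i \<le> card A" using assms(2) by (metis atLeastAtMost_iff)
  then show ?thesis using assms(2) by (simp add: card A)
qed

lemma conj_part_le:
  assumes "shape d (part lam)" "1 \<le> j"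
  shows "conj_part lam j \<le> d"
proof (rule ccontr)
  assume "\<not> conj_part lam j \<le> d"
  then have "j \<le> part lam (Suc d)" using conj_part_iff[OF assms(1), of "Suc d" j] assms(2) by simp
  then show False using assms by (simp add: shape_def)
qed

lemma excited_subset:
  assumes "D \<in> excited lam mu" "diagram mu \<subseteq> diagram lam"
  shows "D \<subseteq> diagram lam"
  using assms by induction (auto simp: active_def)

text \<open>The full diagram has no active cell, since activity requires cells of \<lambda> outside
  the set.\<close>

lemma excited_self:
  assumes "D \<in> excited lam lam"
  shows "D = diagram lam"
  using assms by induction (auto simp: active_def)

lemma shape_part:
  assumes "is_partition l" "length l \<le> d"
  shows "shape d (part l)"
  using assms unfolding shape_def part_def is_partition_def
  by (auto simp: sorted_wrt_iff_nth_less)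

lemma diagram_eq: "diagram l = cells_of (part l)"
  by (simp add: diagram_def cells_of_def)

text \<open>Puts the partition of the entries below \<open>k\<close> into the complement form that
  the weight of \<open>tab_sum\<close> uses.\<close>

lemma nu_part_eq:
  assumes "diagram mu \<subseteq> diagram lam"
  shows "nu_part lam mu T k i = card {j. (i, j) \<in> diagram lam - {c \<in> skew lam mu. k \<le> T c}}"
proof -
  have "nu_diagram lam mu T k = diagram lam - {c \<in> skew lam mu. k \<le> T c}"
    using assms by (auto simp: nu_diagram_def skew_def)
  then show ?thesis by (simp add: nu_part_def)
qed

text \<open>The hypotheses \<open>X0\<close>, \<open>XY\<close> and \<open>ne\<close> keep the
  denominators nonzero. Dividing by the weight \<open>P\<close> of the full diagram turns the
  product over \<open>D\<close> into the inverse product over its complement, and the inverse of a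
  cell weight is \<open>X i / (Y j - X i)\<close>.\<close>

theorem tableaux_excited_identity:
  fixes z :: "nat \<Rightarrow> 'a::field" and lam mu :: "nat list"
  assumes d: "1 \<le> d" and lam: "shape d (part lam)" and mu: "shape d (part mu)"
    and sub: "diagram mu \<subseteq> diagram lam"
    and X: "\<And>i. X i = z (part lam i + d + 1 - i)" and Y: "\<And>j. Y j = z (d + j - conj_part lam j)"
    and X0: "\<And>i. 1 \<le> i \<Longrightarrow> i \<le> d \<Longrightarrow> X i \<noteq> 0"
    and XY: "\<And>i j. (i, j) \<in> diagram lam \<Longrightarrow> Y j \<noteq> X i"
    and ne: "\<And>m. shape d m \<Longrightarrow> (\<And>i. m i \<le> part lam i) \<Longrightarrow> m \<noteq> part lam \<Longrightarrow>
      (\<Prod>i=1..d. z (m i + d + 1 - i) / X i) \<noteq> 1"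
  shows "(\<Sum>T\<in>SIT lam mu. \<Prod>k=1..sit_max lam mu T.
      inverse ((\<Prod>i=1..d. z (nu_part lam mu T k i + d + 1 - i) / X i) - 1)) =
    (\<Sum>D\<in>excited lam mu. \<Prod>(i, j)\<in>diagram lam - D. X i / (Y j - X i))"
proof -
  define l where "l = part lam"
  define m where "m = part mu"
  define p where "p = (\<lambda>(i, j). Y j / X i - 1)"
  define \<phi> where "\<phi> K = inverse ((\<Prod>i=1..d. z (card {j. (i, j) \<in> cells_of l - K} + d + 1 - i) / X i) - 1)" for K
  define P where "P = (\<Prod>x\<in>cells_of l. p x)"
  have l: "shape d l" "diagram lam = cells_of l" and m: "shape d m" "diagram mu = cells_of m"
    using lam mu by (simp_all add: l_def m_def diagram_eq)
  have ml: "m i \<le> l i" for i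
  proof (cases "1 \<le> i \<and> 1 \<le> m i")
    case True
    then have "(i, m i) \<in> diagram mu" by (simp add: m(2))
    then have "(i, m i) \<in> cells_of l" using sub unfolding l(2) by blast
    then show ?thesis by simp
  next
    case False
    then show ?thesis using m(1) by (cases "i = 0") (auto simp: shape_def)
  qed
  have id: "i \<le> d" if "(i, j) \<in> cells_of l" for i j
    using that l(1) by (auto simp: shape_def intro: ccontr)
  have p0: "p x \<noteq> 0" if "x \<in> cells_of l" for x
  proof -
    obtain i j where x: "x = (i, j)" by (cases x)
    have "X i \<noteq> 0" using that id[of i j] X0[of i] by (simp add: x)
    moreover have "Y j \<noteq> X i" using that unfolding x by (intro XY) (simp only: l(2))
    ultimately show ?thesis unfolding x p_def prod.case by simp
  qed
  have fin: "finite (cells_of l)" by (rule finite_cells_of[OF l(1)])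
  have P0: "P \<noteq> 0" unfolding P_def prod_zero_iff[OF fin] using p0 by blast
  have eig: "eigen (\<Prod>i=1..d. X i) z (subword_sum d p (reading_word l d (l d)))"
    unfolding p_def
  proof (rule eigen_reading_word[OF l(1) X0])
    show "i \<le> conj_part lam j \<longleftrightarrow> j \<le> l i" if "1 \<le> i" "1 \<le> j" for i j
      unfolding l_def by (rule conj_part_iff[OF lam that])
    fix j assume j: "1 \<le> j" "j \<le> l 1"
    \<comment> \<open>At the end of the word the truncated column height is the true one.\<close>
    have "conj_part lam j \<le> d" by (rule conj_part_le[OF lam j(1)])
    moreover have "conj_part lam j \<le> d - 1" if "\<not> j \<le> l d"
      using conj_part_iff[OF lam d, of j] that j by (auto simp: l_def)
    ultimately have "min (conj_part lam j) (if j \<le> l d then d else d - 1) = conj_part lam j" by auto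
    then show "z (d + j - min (conj_part lam j) (if j \<le> l d then d else d - 1)) = Y j"
      by (simp add: Y)
  qed (use d in \<open>simp_all add: stage_full[OF lam] X l_def\<close>)
  have exc: "excited lam mu = {D. D \<subseteq> cells_of l \<and> demazure d D (reading_word l d (l d)) = Some (particles d m)}"
    by (rule excited_eq_demazure) (use l m ml d in auto)
  have set: "set (reading_word l d (l d)) = cells_of l" using d by (simp add: set_reading_word stage_full[OF l(1)])
  \<comment> \<open>Computing the excited diagrams of \<lambda>/\<lambda> in two ways shows that the
    full diagram is the only subword with product \<open>particles d l\<close>.\<close>
  have "excited lam lam = {D. D \<subseteq> cells_of l \<and> demazure d D (reading_word l d (l d)) = Some (particles d l)}"
    by (rule excited_eq_demazure) (use l d in auto)
  moreover have "excited lam lam = {cells_of l}"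
  proof (intro equalityI subsetI)
    fix D assume "D \<in> excited lam lam"
    then show "D \<in> {cells_of l}" using excited_self[of D lam] l(2) by simp
  qed (use excited.base[of lam lam] l(2) in simp)
  ultimately have "{D. D \<subseteq> cells_of l \<and> demazure d D (reading_word l d (l d)) = Some (particles d l)} = {cells_of l}"
    by simp
  then have top: "subword_sum d p (reading_word l d (l d)) (particles d l) = P"
    unfolding subword_sum_def set P_def by simp
  have "(\<Sum>T\<in>SIT lam mu. \<Prod>k=1..sit_max lam mu T.
      inverse ((\<Prod>i=1..d. z (nu_part lam mu T k i + d + 1 - i) / X i) - 1)) =
      tab_sum \<phi> (cells_of l - cells_of m)"
    unfolding tab_sum_def sit_max_def nu_part_eq[OF sub] \<phi>_def SIT_def tableaux_def skew_def l(2) m(2) ..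
  also have "\<dots> = subword_sum d p (reading_word l d (l d)) (particles d m) / P"
    by (rule tab_sum_eq_subword_sum[OF l(1) d m(1) ml X0 eig top P0])
      (use ne in \<open>simp_all add: l_def \<phi>_def\<close>)
  also have "\<dots> = (\<Sum>D\<in>excited lam mu. (\<Prod>x\<in>D. p x) / P)"
    unfolding subword_sum_def exc set by (rule sum_divide_distrib)
  also have "\<dots> = (\<Sum>D\<in>excited lam mu. \<Prod>(i, j)\<in>diagram lam - D. X i / (Y j - X i))"
  proof (rule sum.cong[OF refl])
    fix D assume "D \<in> excited lam mu"
    then have D: "D \<subseteq> cells_of l" by (simp add: exc)
    have "P = (\<Prod>x\<in>cells_of l - D. p x) * (\<Prod>x\<in>D. p x)"
      unfolding P_def by (rule prod.subset_diff[OF D fin])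
    then have "(\<Prod>x\<in>D. p x) / P = inverse (\<Prod>x\<in>cells_of l - D. p x)"
      using P0 by (simp add: field_simps)
    also have "\<dots> = (\<Prod>x\<in>cells_of l - D. inverse (p x))" by (rule prod_inversef[symmetric, unfolded o_def])
    also have "\<dots> = (\<Prod>(i, j)\<in>cells_of l - D. X i / (Y j - X i))"
    proof (rule prod.cong[OF refl], clarify)
      fix i j assume ij: "(i, j) \<in> cells_of l" "(i, j) \<notin> D"
      have "X i \<noteq> 0" using ij id[of i j] X0[of i] by simp
      then show "inverse (p (i, j)) = X i / (Y j - X i)" by (simp add: p_def field_simps)
    qed
    finally show "(\<Prod>x\<in>D. p x) / P = (\<Prod>(i, j)\<in>diagram lam - D. X i / (Y j - X i))"
      by (simp only: l(2))
  qed
  finally show ?thesis .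
qed

section \<open>The parameters 1 + \<beta> q^k, with nondegeneracy checked by a numerical
  evaluation\<close>

section \<open>Specialization to rational functions\<close>

definition lin_factor :: "nat \<Rightarrow> rat poly poly" where
  "lin_factor k = 1 + [:0, 1:] * [:[:0, 1:]:] ^ k"

text \<open>Evaluation at \<beta> = 1, the outer variable, and then q = 2. It sends the linear
  factors to positive rationals that increase strictly with the exponent.\<close>

definition specialize :: "rat poly poly \<Rightarrow> rat" where
  "specialize p = poly (poly p 1) 2"

lemma specialize_lin_factor: "specialize (lin_factor k) = 1 + 2 ^ k"
  by (simp add: specialize_def lin_factor_def)

lemma specialize_prod: "specialize (\<Prod>i\<in>A. f i) = (\<Prod>i\<in>A. specialize (f i))"
  by (simp add: specialize_def poly_prod)

lemma to_fract_prod: "to_fract (\<Prod>i\<in>A. f i) = (\<Prod>i\<in>A. to_fract (f i))"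
  by (induction A rule: infinite_finite_induct) auto

lemma to_fract_power: "to_fract (p ^ n) = to_fract p ^ n"
  by (induction n) auto

lemma to_fract_lin_factor: "to_fract (lin_factor k) = 1 + var_beta * var_q ^ k"
  unfolding lin_factor_def var_beta_def var_q_def to_fract_def[symmetric]
  by (simp only: to_fract_add to_fract_1 to_fract_mult to_fract_power)

text \<open>At \<beta> = 1, q = 2 all factors are positive and monotone in the exponent, so one
  strictly longer row makes the product strictly larger.\<close>

lemma prod_lin_factor_ne:
  assumes "\<And>i. m i \<le> l i" "m i \<noteq> l i" "1 \<le> i" "i \<le> d"
  shows "(\<Prod>i=1..d. lin_factor (m i + d + 1 - i)) \<noteq> (\<Prod>i=1..d. lin_factor (l i + d + 1 - i))"
proof
  define g :: "(nat \<Rightarrow> nat) \<Rightarrow> nat \<Rightarrow> rat" where "g m i = 1 + 2 ^ (m i + d + 1 - i)" for m i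
  assume "(\<Prod>i=1..d. lin_factor (m i + d + 1 - i)) = (\<Prod>i=1..d. lin_factor (l i + d + 1 - i))"
  then have eq: "(\<Prod>i=1..d. g m i) = (\<Prod>i=1..d. g l i)"
    by (metis (mono_tags, lifting) specialize_prod specialize_lin_factor g_def prod.cong)
  have pos: "0 < g f k" for f k by (simp add: g_def add_pos_pos)
  have le: "g m k \<le> g l k" for k
    using assms(1)[of k] by (auto simp: g_def intro!: power_increasing)
  have "m i + d + 1 - i < l i + d + 1 - i" using assms(1)[of i] assms(2-4) by arith
  then have less: "g m i < g l i" unfolding g_def by (intro add_strict_left_mono power_strict_increasing) auto
  have "(\<Prod>k=1..d. g m k) = g m i * (\<Prod>k\<in>{1..d} - {i}. g m k)"
    by (rule prod.remove) (use assms in auto)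
  also have "\<dots> \<le> g m i * (\<Prod>k\<in>{1..d} - {i}. g l k)"
    using pos le by (intro mult_left_mono prod_mono) (auto intro: less_imp_le)
  also have "\<dots> < g l i * (\<Prod>k\<in>{1..d} - {i}. g l k)"
    using less pos by (intro mult_strict_right_mono prod_pos) auto
  also have "\<dots> = (\<Prod>k=1..d. g l k)"
    by (rule prod.remove[symmetric]) (use assms in auto)
  finally show False using eq by simp
qed

text \<open>For a cell, the exponent in \<open>X i\<close> is the exponent in \<open>Y j\<close>
  plus the hook length \<open>h\<close>, so \<open>Y j - X i\<close> equals \<beta> q^b (1 - q^h)
  with \<open>b\<close> the exponent in \<open>Y j\<close>. The factors \<beta> of the cells outside
  \<open>D\<close> collect to the power of \<beta> on the right.\<close>

theorem theorem6p6:
  fixes d :: nat and lam mu :: "nat list"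
  assumes "d \<ge> 1"
    and "is_partition lam" and "is_partition mu"
    and "diagram mu \<subseteq> diagram lam"
    and "length lam \<le> d"
  shows "(\<Sum>T \<in> SIT lam mu. \<Prod>k = 1..sit_max lam mu T.
            inverse ((\<Prod>i = 1..d.
                (1 + var_beta * var_q ^ (nu_part lam mu T k i + d - i + 1)) /
                (1 + var_beta * var_q ^ (part lam i + d - i + 1))) - 1))
       = (\<Sum>D \<in> excited lam mu.
            var_beta powi (int (card D) - int (card (diagram lam))) *
            (\<Prod>(i, j) \<in> diagram lam - D.
               (var_beta * var_q ^ (part lam i + d - i + 1) + 1) /
               (var_q ^ (d + j - conj_part lam j) * (1 - var_q ^ hook lam i j))))"
proof -
  define z :: "nat \<Rightarrow> rfun" where "z k = 1 + var_beta * var_q ^ k" for k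
  define X where "X i = z (part lam i + d + 1 - i)" for i
  define Y where "Y j = z (d + j - conj_part lam j)" for j
  have z: "z k = to_fract (lin_factor k)" for k by (simp add: z_def to_fract_lin_factor)
  have z0: "z k \<noteq> 0" for k
  proof -
    have "specialize (lin_factor k) \<noteq> specialize 0"
      unfolding specialize_lin_factor by (simp add: specialize_def add_pos_pos[THEN less_imp_neq[THEN not_sym]])
    then show ?thesis unfolding z by auto
  qed
  have z_inj: "a = b" if "z a = z b" for a b
  proof -
    have "specialize (lin_factor a) = specialize (lin_factor b)" using that by (simp add: z)
    then show ?thesis by (simp add: specialize_lin_factor)
  qed
  have beta0: "var_beta \<noteq> 0" by (simp add: var_beta_def flip: to_fract_def)
  have lam: "shape d (part lam)" by (rule shape_part) (use assms in auto)
  have part_le: "part mu i \<le> part lam i" if "1 \<le> i" for i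
  proof (cases "part mu i = 0")
    case False
    then have "(i, part mu i) \<in> diagram mu" using that by (simp add: diagram_eq)
    then have "(i, part mu i) \<in> diagram lam" using assms(4) by blast
    then show ?thesis by (simp add: diagram_eq)
  qed simp
  have mu: "shape d (part mu)"
  proof -
    \<comment> \<open>The bound \<open>max d (length mu)\<close> is provisional: rows of \<mu>
      beyond \<open>d\<close> are empty because they are empty in \<lambda>.\<close>
    have "shape (max d (length mu)) (part mu)" by (rule shape_part) (use assms in auto)
    moreover have "part mu i = 0" if "d < i" for i using part_le[of i] lam that by (simp add: shape_def)
    ultimately show ?thesis unfolding shape_def by blast
  qed
  have cell: "i \<le> d" "d + j - conj_part lam j + hook lam i j = part lam i + d + 1 - i" "1 \<le> hook lam i j"
    if "(i, j) \<in> diagram lam" for i j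
  proof -
    have ij: "1 \<le> i" "1 \<le> j" "j \<le> part lam i" using that by (simp_all add: diagram_eq)
    show id: "i \<le> d" using ij lam by (auto simp: shape_def intro: ccontr)
    have "i \<le> conj_part lam j" using conj_part_iff[OF lam ij(1,2)] ij(3) by simp
    then show "d + j - conj_part lam j + hook lam i j = part lam i + d + 1 - i"
      using ij id conj_part_le[OF lam ij(2)] by (simp add: hook_def)
    show "1 \<le> hook lam i j" by (simp add: hook_def)
  qed
  have fin: "finite (diagram lam)" unfolding diagram_eq by (rule finite_cells_of[OF lam])
  have "(\<Sum>T \<in> SIT lam mu. \<Prod>k = 1..sit_max lam mu T.
            inverse ((\<Prod>i = 1..d.
                (1 + var_beta * var_q ^ (nu_part lam mu T k i + d - i + 1)) /
                (1 + var_beta * var_q ^ (part lam i + d - i + 1))) - 1)) =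
    (\<Sum>T\<in>SIT lam mu. \<Prod>k=1..sit_max lam mu T.
      inverse ((\<Prod>i=1..d. z (nu_part lam mu T k i + d + 1 - i) / X i) - 1))"
    \<comment> \<open>For \<open>i\<close> at most \<open>d\<close> the two ways of writing the
      exponents agree despite truncated subtraction.\<close>
    by (intro sum.cong prod.cong arg_cong[where f = inverse] arg_cong2[where f = minus] refl)
      (simp add: z_def X_def Suc_diff_le)
  also have "\<dots> = (\<Sum>D\<in>excited lam mu. \<Prod>(i, j)\<in>diagram lam - D. X i / (Y j - X i))"
  proof (rule tableaux_excited_identity[OF assms(1) lam mu assms(4) X_def Y_def])
    show "X i \<noteq> 0" for i by (simp add: X_def z0)
    \<comment> \<open>Hook lengths are positive, so the two exponents differ.\<close>
    show "Y j \<noteq> X i" if "(i, j) \<in> diagram lam" for i j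
      using z_inj[of "d + j - conj_part lam j" "part lam i + d + 1 - i"] cell(2,3)[OF that]
      by (auto simp: X_def Y_def)
  next
    fix m assume m: "shape d m" "\<And>i. m i \<le> part lam i" "m \<noteq> part lam"
    then obtain i where i: "m i \<noteq> part lam i" by auto
    have id: "1 \<le> i \<and> i \<le> d"
    proof (rule ccontr)
      assume "\<not> (1 \<le> i \<and> i \<le> d)"
      then have "i = 0 \<or> d < i" by auto
      then show False using i m(1) lam by (auto simp: shape_def)
    qed
    have "(\<Prod>i=1..d. z (m i + d + 1 - i)) \<noteq> (\<Prod>i=1..d. X i)"
      unfolding X_def z to_fract_prod[symmetric] to_fract_eq_iff
      by (rule prod_lin_factor_ne[where i = i]) (use m(2) i id in auto)
    moreover have "(\<Prod>i=1..d. X i) \<noteq> 0" by (simp add: X_def z0)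
    ultimately show "(\<Prod>i=1..d. z (m i + d + 1 - i) / X i) \<noteq> 1"
      by (simp add: prod_dividef)
  qed
  also have "\<dots> = (\<Sum>D \<in> excited lam mu.
            var_beta powi (int (card D) - int (card (diagram lam))) *
            (\<Prod>(i, j) \<in> diagram lam - D.
               (var_beta * var_q ^ (part lam i + d - i + 1) + 1) /
               (var_q ^ (d + j - conj_part lam j) * (1 - var_q ^ hook lam i j))))"
  proof (rule sum.cong[OF refl])
    fix D assume "D \<in> excited lam mu"
    then have D: "D \<subseteq> diagram lam" using excited_subset assms(4) by blast
    define t where "t = (\<lambda>(i, j). (var_beta * var_q ^ (part lam i + d - i + 1) + 1) /
               (var_q ^ (d + j - conj_part lam j) * (1 - var_q ^ hook lam i j)))"
    have le: "card D \<le> card (diagram lam)" using D fin by (rule card_mono[rotated])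
    \<comment> \<open>Each cell outside \<open>D\<close> supplies one factor 1 / \<beta>.\<close>
    have "card (diagram lam - D) = card (diagram lam) - card D"
      using D fin by (meson card_Diff_subset finite_subset)
    then have "int (card D) - int (card (diagram lam)) = - int (card (diagram lam - D))"
      using le by simp
    then have pw: "var_beta powi (int (card D) - int (card (diagram lam))) = (\<Prod>x\<in>diagram lam - D. inverse var_beta)"
      by (simp add: power_int_minus power_inverse)
    have "(\<Prod>(i, j)\<in>diagram lam - D. X i / (Y j - X i)) = (\<Prod>x\<in>diagram lam - D. inverse var_beta * t x)"
    proof (rule prod.cong[OF refl], clarify)
      fix i j assume ij: "(i, j) \<in> diagram lam" "(i, j) \<notin> D"
      define b where "b = d + j - conj_part lam j"
      define h where "h = hook lam i j"
      have e: "part lam i + d + 1 - i = b + h" "part lam i + d - i + 1 = b + h"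
        using cell(1,2)[OF ij(1)] by (simp_all add: b_def h_def)
      have "Y j - X i = var_beta * (var_q ^ b * (1 - var_q ^ h))"
        unfolding X_def Y_def z_def e b_def[symmetric] by (simp add: algebra_simps power_add)
      moreover have "X i = var_beta * var_q ^ (b + h) + 1"
        unfolding X_def z_def e by simp
      ultimately show "X i / (Y j - X i) = inverse var_beta * t (i, j)"
        unfolding t_def prod.case e b_def[symmetric] h_def[symmetric] by (simp add: field_simps)
    qed
    then show "(\<Prod>(i, j)\<in>diagram lam - D. X i / (Y j - X i)) =
        var_beta powi (int (card D) - int (card (diagram lam))) *
        (\<Prod>(i, j) \<in> diagram lam - D.
               (var_beta * var_q ^ (part lam i + d - i + 1) + 1) /
               (var_q ^ (d + j - conj_part lam j) * (1 - var_q ^ hook lam i j)))"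
      unfolding pw t_def by (simp only: prod.distrib)
  qed
  finally show ?thesis .
qed

end
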